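(* Let $H,U$ be real Hilbert spaces, let $-A$ generate a compact $C_0$-semigroup on $H$, and let $B(t)\equiv B\in\mathcal{L}(H)$ and $D(t)\equiv D\in\mathcal{L}(U,H)$ be time-invariant. Then the following statements about the equation $y'(t)+Ay(t)+By(t)=Du(t)$, $t\ge0$, are equivalent: (i) The equation is linear $\hat T$-periodic feedback stabilizable for some $\hat T>0$. (ii) The equation is linear $\hat T$-periodic feedback stabilizable for every $\hat T>0$. (iii) The equation is linear time-invariant feedback stabilizable.
   Context: $\mathcal{L}(X,Y)$ is the space of bounded linear operators, $\mathcal{L}(X)=\mathcal{L}(X,X)$, $\mathbb{R}^+=[0,\infty)$. A compact $C_0$-semigroup is one whose operators are compact for each $t>0$. Solutions are mild solutions. The equation is linear $\hat T$-periodic feedback stabilizable if there is a $\hat T$-periodic $K(\cdot)\in L^\infty(\mathbb{R}^+;\mathcal{L}(H,U))$ such that the feedback equation $y'(t)+Ay(t)+By(t)=DK(t)y(t)$ on $\mathbb{R}^+$ is exponentially stable, i.e. there are constants $M,\delta>0$ such that for every $h\in H$ its mild solution with $y(0)=h$ satisfies $\|y(t)\|\le Me^{-\delta t}\|h\|$ for all $t\ge0$. It is linear time-invariant feedback stabilizable if this holds with some constant $K(\cdot)\equiv K\in\mathcal{L}(H,U)$. *)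

theory Defs
  imports "HOL-Analysis.Analysis"
begin

text \<open>Real Hilbert spaces are rendered by the sort \<open>{real_inner, banach}\<close>; no separability is assumed.\<close>

definition compact_blinfun :: "('a::real_normed_vector \<Rightarrow>\<^sub>L 'b::real_normed_vector) \<Rightarrow> bool" where
  "compact_blinfun F \<longleftrightarrow> (\<forall>X. bounded X \<longrightarrow> compact (closure (blinfun_apply F ` X)))"

text \<open>A semigroup is a function on all of \<open>real\<close> of which only the values at \<open>t \<ge> 0\<close> matter.\<close>

definition C0_semigroup :: "(real \<Rightarrow> 'h::real_normed_vector \<Rightarrow>\<^sub>L 'h) \<Rightarrow> bool" where
  "C0_semigroup S \<longleftrightarrow>
     S 0 = id_blinfun \<and>
     (\<forall>s\<ge>0. \<forall>t\<ge>0. S (s + t) = S s o\<^sub>L S t) \<and>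
     (\<forall>x. ((\<lambda>t. S t x) \<longlongrightarrow> x) (at_right 0))"

definition compact_C0_semigroup :: "(real \<Rightarrow> 'h::real_normed_vector \<Rightarrow>\<^sub>L 'h) \<Rightarrow> bool" where
  "compact_C0_semigroup S \<longleftrightarrow> C0_semigroup S \<and> (\<forall>t>0. compact_blinfun (S t))"

text \<open>An unbounded operator is a pair of a domain \<open>V\<close> and a function \<open>G\<close>, whose values
  outside \<open>V\<close> are irrelevant.\<close>

definition generates ::
    "'h set \<Rightarrow> ('h \<Rightarrow> 'h) \<Rightarrow> (real \<Rightarrow> 'h::real_normed_vector \<Rightarrow>\<^sub>L 'h) \<Rightarrow> bool" where
  "generates V G S \<longleftrightarrow>
     V = {x. \<exists>y. ((\<lambda>t. (S t x - x) /\<^sub>R t) \<longlongrightarrow> y) (at_right 0)} \<and>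
     (\<forall>x\<in>V. ((\<lambda>t. (S t x - x) /\<^sub>R t) \<longlongrightarrow> G x) (at_right 0))"

text \<open>Membership in \<open>L\<^sup>\<infinity>(\<real>\<^sup>+; X)\<close> in the Bochner sense. The general notion of
  \<^const>\<open>borel_measurable\<close> would be too weak here, since \<open>X\<close> (a space of operators) need not be
  separable.\<close>

definition L_infinity :: "(real \<Rightarrow> 'x::real_normed_vector) \<Rightarrow> bool" where
  "L_infinity K \<longleftrightarrow>
     (\<exists>s. (\<forall>n::nat. simple_function lebesgue (s n)) \<and>
          (AE t in lebesgue. t \<ge> 0 \<longrightarrow> (\<lambda>n. s n t) \<longlonglongrightarrow> K t)) \<and>
     (\<exists>C. AE t in lebesgue. t \<ge> 0 \<longrightarrow> norm (K t) \<le> C)"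

text \<open>Mild solutions of \<open>y'(t) + A y(t) + B y(t) = D K(t) y(t)\<close>, \<open>y(0) = h\<close>, where \<open>S\<close> is the
  semigroup generated by \<open>-A\<close>; that is,
  \<open>y(t) = S(t) h + \<integral>\<^sub>0\<^sup>t S(t - s) (D K(s) y(s) - B y(s)) ds\<close>.
  The library's Bochner integral is restricted to second countable spaces, so the integral is the
  Henstock-Kurzweil one; for \<open>K\<close> in \<open>L\<^sup>\<infinity>\<close> and continuous \<open>y\<close> the integrand is Bochner integrable
  and the two integrals agree.\<close>

definition mild_solution ::
    "(real \<Rightarrow> 'h::real_normed_vector \<Rightarrow>\<^sub>L 'h) \<Rightarrow> ('h \<Rightarrow>\<^sub>L 'h) \<Rightarrow> ('u::real_normed_vector \<Rightarrow>\<^sub>L 'h) \<Rightarrow>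
     (real \<Rightarrow> 'h \<Rightarrow>\<^sub>L 'u) \<Rightarrow> 'h \<Rightarrow> (real \<Rightarrow> 'h) \<Rightarrow> bool" where
  "mild_solution S B D K h y \<longleftrightarrow>
     continuous_on {0..} y \<and>
     (\<forall>t\<ge>0. ((\<lambda>s. S (t - s) (D (K s (y s)) - B (y s))) has_integral (y t - S t h)) {0..t})"

definition exponentially_stable ::
    "(real \<Rightarrow> 'h::real_normed_vector \<Rightarrow>\<^sub>L 'h) \<Rightarrow> ('h \<Rightarrow>\<^sub>L 'h) \<Rightarrow> ('u::real_normed_vector \<Rightarrow>\<^sub>L 'h) \<Rightarrow>
     (real \<Rightarrow> 'h \<Rightarrow>\<^sub>L 'u) \<Rightarrow> bool" where
  "exponentially_stable S B D K \<longleftrightarrow>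
     (\<exists>M>0. \<exists>\<delta>>0. \<forall>h.
        (\<exists>y. mild_solution S B D K h y) \<and>
        (\<forall>y. mild_solution S B D K h y \<longrightarrow>
             (\<forall>t\<ge>0. norm (y t) \<le> M * exp (- \<delta> * t) * norm h)))"

text \<open>Periodicity is required almost everywhere, as \<open>K\<close> stands for an \<open>L\<^sup>\<infinity>\<close> class.\<close>

definition periodic_feedback_stabilizable ::
    "(real \<Rightarrow> 'h::real_normed_vector \<Rightarrow>\<^sub>L 'h) \<Rightarrow> ('h \<Rightarrow>\<^sub>L 'h) \<Rightarrow> ('u::real_normed_vector \<Rightarrow>\<^sub>L 'h) \<Rightarrow>
     real \<Rightarrow> bool" where
  "periodic_feedback_stabilizable S B D T \<longleftrightarrow>
     (\<exists>K. L_infinity K \<and> (AE t in lebesgue. t \<ge> 0 \<longrightarrow> K (t + T) = K t) \<and>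
          exponentially_stable S B D K)"

definition time_invariant_feedback_stabilizable ::
    "(real \<Rightarrow> 'h::real_normed_vector \<Rightarrow>\<^sub>L 'h) \<Rightarrow> ('h \<Rightarrow>\<^sub>L 'h) \<Rightarrow> ('u::real_normed_vector \<Rightarrow>\<^sub>L 'h) \<Rightarrow>
     bool" where
  "time_invariant_feedback_stabilizable S B D \<longleftrightarrow>
     (\<exists>K. exponentially_stable S B D (\<lambda>t. K))"

end

theory Submission
  imports Defs
begin

text \<open>A constant feedback is a \<open>T\<close>-periodic feedback for every \<open>T\<close>, so the content of the theorem is that a
  stabilizing periodic feedback can be replaced by a constant one. The proof uses the periodic feedback
  only through the controls that it generates and finds the constant feedback by linear-quadratic
  optimal control.

  Since the periodic loop is exponentially stable, every initial value \<open>h\<close> has a control \<open>u\<close> for which the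
  trajectory \<open>y\<close> satisfies \<open>\<integral> (norm y)\<^sup>2 + (norm u)\<^sup>2 \<le> C * (norm h)\<^sup>2\<close>
  (\<open>admissible_cost_of_stable_feedback\<close>). Let \<open>V h\<close> be the infimum of this cost over all controls. The
  equation does not depend on time, so neither does \<open>V\<close>; trajectories can be added, so \<open>V\<close> satisfies the
  parallelogram law and is the quadratic form of a bounded symmetric bilinear form \<open>b\<close>
  (\<open>optimal_cost_quadratic\<close>). The constant feedback is the classical \<open>K = - D* P\<close>, that is,
  \<open>K h \<bullet> v = - b h (D v)\<close>.

  The closed loop with \<open>K\<close> is stable because \<open>V\<close> decreases along it at the rate \<open>(norm y)\<^sup>2\<close> at least. This
  combines two expansions for short times \<open>r\<close>. Bellman's principle for nearly optimal trajectories gives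
  \<open>V (S r h) \<le> V h - r * ((norm h)\<^sup>2 - 2 * b h (B h) - (norm (K h))\<^sup>2) + o(r)\<close>
  (\<open>optimal_cost_lower_expansion\<close>), and for the closed-loop orbit \<open>y\<close> from \<open>h\<close> one has
  \<open>V (y r) = V (S r h) + 2 * r * b h (D (K h) - B h) + o(r)\<close>. Both are taken relative to the free orbit
  \<open>S r h\<close>, which need not be differentiable in \<open>r\<close>; so every \<open>h\<close> can be treated alike. The first expansion has to be uniform in the unknown control, which is where strong
  continuity of the adjoint semigroup comes in (\<open>dual_orbit_continuous\<close>).

  Integrating, \<open>\<integral> (norm y)\<^sup>2 \<le> V h \<le> C * (norm h)\<^sup>2\<close> for all closed-loop orbits, and by Datko's theorem
  (\<open>exponential_decay_if_square_integrable\<close>) this forces exponential decay.\<close>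

section \<open>Functional analysis\<close>

lemma parallelogram_law:
  fixes x y :: "'a::real_inner"
  shows "(norm (x + y))\<^sup>2 + (norm (x - y))\<^sup>2 = 2 * (norm x)\<^sup>2 + 2 * (norm y)\<^sup>2"
  unfolding power2_norm_eq_inner by (simp add: inner_add inner_diff inner_commute)

text \<open>The Riesz representation theorem and the orthogonal projection in one statement: for \<open>Z = UNIV\<close> it
  represents \<open>f\<close>, and for \<open>f = (\<bullet>) p\<close> it yields the projection of \<open>p\<close> onto \<open>Z\<close>. The representing element
  minimizes \<open>(norm x)\<^sup>2 - 2 * f x\<close> over \<open>Z\<close>; minimizing sequences are Cauchy by the parallelogram law.\<close>

lemma Riesz_on_closed_subspace:
  fixes f :: "'a::{real_inner, banach} \<Rightarrow> real"
  assumes f: "bounded_linear f" and Z: "subspace Z" "closed Z"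
  shows "\<exists>z\<in>Z. \<forall>x\<in>Z. f x = z \<bullet> x"
proof -
  interpret f: bounded_linear f by (rule f)
  define J where "J x = (norm x)\<^sup>2 - 2 * f x" for x
  obtain c where c: "\<And>x. norm (f x) \<le> norm x * c"
    using f.bounded by blast
  have low: "- (c\<^sup>2) \<le> J x" for x
  proof -
    have "f x \<le> norm x * c" using c[of x] by simp
    moreover have "0 \<le> (norm x - c)\<^sup>2" by simp
    ultimately show ?thesis unfolding J_def by (simp add: power2_diff)
  qed
  define m where "m = Inf (J ` Z)"
  have bb: "bdd_below (J ` Z)" using low by (auto intro!: bdd_belowI)
  have ne: "Z \<noteq> {}" using subspace_0[OF Z(1)] by auto
  have m: "m \<le> J x" if "x \<in> Z" for x
    unfolding m_def using bb that by (intro cInf_lower) auto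
  have "\<exists>x\<in>Z. J x < m + 1 / real (Suc n)" for n
  proof -
    have "m < m + 1 / real (Suc n)" by simp
    then show ?thesis
      unfolding m_def using cInf_less_iff[of "J ` Z"] ne bb by (metis (no_types, lifting) imageE image_is_empty)
  qed
  then obtain X where X: "\<And>n. X n \<in> Z" "\<And>n. J (X n) < m + 1 / real (Suc n)" by metis
  \<comment> \<open>parallelogram identity at the midpoint of two almost minimizers\<close>
  have par: "(norm (X i - X j))\<^sup>2 \<le> 2 / real (Suc i) + 2 / real (Suc j)" for i j
  proof -
    have mid: "(1/2) *\<^sub>R (X i + X j) \<in> Z"
      using X(1) Z(1) by (simp add: subspace_add subspace_scale)
    have "J (X i) + J (X j) - 2 * J ((1/2) *\<^sub>R (X i + X j)) = (norm (X i - X j))\<^sup>2 / 2"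
      unfolding J_def power2_norm_eq_inner
      by (simp add: f.add f.scaleR inner_add inner_diff inner_commute algebra_simps)
    moreover have "m \<le> J ((1/2) *\<^sub>R (X i + X j))" by (rule m[OF mid])
    moreover have "2 / real (Suc k) = 2 * (1 / real (Suc k))" for k by simp
    ultimately show ?thesis using X(2)[of i] X(2)[of j] by linarith
  qed
  have "Cauchy X"
  proof (rule metric_CauchyI)
    fix e :: real assume e: "0 < e"
    obtain N where N: "4 / e\<^sup>2 < real (Suc N)"
      using reals_Archimedean2[of "4 / e\<^sup>2"] by (metis less_trans lessI of_nat_less_iff)
    have "dist (X i) (X j) < e" if "N \<le> i" "N \<le> j" for i j
    proof -
      have "2 / real (Suc i) \<le> 2 / real (Suc N)" "2 / real (Suc j) \<le> 2 / real (Suc N)"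
        using that by (auto intro!: divide_left_mono)
      then have "(norm (X i - X j))\<^sup>2 \<le> 4 / real (Suc N)" using par[of i j] by simp
      also have "\<dots> < e\<^sup>2" using N e by (simp add: field_simps)
      finally show ?thesis unfolding dist_norm using e by (simp add: power2_less_imp_less)
    qed
    then show "\<exists>M. \<forall>i\<ge>M. \<forall>j\<ge>M. dist (X i) (X j) < e" by blast
  qed
  then obtain z where z: "X \<longlonglongrightarrow> z" using Cauchy_convergent_iff convergent_def by blast
  have zZ: "z \<in> Z" using closed_sequentially[OF Z(2)] X(1) z by blast
  have "(\<lambda>n. J (X n)) \<longlonglongrightarrow> J z"
    unfolding J_def by (intro tendsto_intros z f.tendsto)
  moreover have "(\<lambda>n. m + 1 / real (Suc n)) \<longlonglongrightarrow> m + 0"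
    by (intro tendsto_intros LIMSEQ_Suc[OF lim_1_over_n])
  ultimately have Jz: "J z \<le> m"
    using X(2) less_imp_le LIMSEQ_le[of "\<lambda>n. J (X n)" "J z" "\<lambda>n. m + 1 / real (Suc n)" m] by auto
  have "f x = z \<bullet> x" if x: "x \<in> Z" for x
  proof (cases "x = 0")
    case False
    define a where "a = (f x - z \<bullet> x) / (norm x)\<^sup>2"
    have n: "(norm x)\<^sup>2 > 0" using False by simp
    have "z + a *\<^sub>R x \<in> Z" using x zZ Z(1) by (simp add: subspace_add subspace_scale)
    from m[OF this] Jz have "J z \<le> J (z + a *\<^sub>R x)" by simp
    moreover have "J (z + a *\<^sub>R x) = J z + 2 * a * (z \<bullet> x - f x) + a\<^sup>2 * (norm x)\<^sup>2"
      unfolding J_def power2_norm_eq_inner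
      by (simp add: f.add f.scaleR inner_add inner_commute algebra_simps power2_eq_square)
    moreover have "2 * a * (z \<bullet> x - f x) + a\<^sup>2 * (norm x)\<^sup>2 = - ((f x - z \<bullet> x)\<^sup>2 / (norm x)\<^sup>2)"
    proof -
      have "2 * (q / N) * (- q) + (q / N)\<^sup>2 * N = - (q\<^sup>2 / N)" if "N > 0" for q N :: real
        using that by (simp add: field_simps power2_eq_square)
      from this[OF n, of "f x - z \<bullet> x"] show ?thesis unfolding a_def by simp
    qed
    ultimately have "(f x - z \<bullet> x)\<^sup>2 / (norm x)\<^sup>2 \<le> 0" by linarith
    then have "(f x - z \<bullet> x)\<^sup>2 \<le> 0" using n by (simp add: divide_le_0_iff)
    then show ?thesis by simp
  qed (simp add: f.zero)
  with zZ show ?thesis by blast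
qed

text \<open>By Baire's theorem one of the closed sets on which all \<open>F n\<close> are bounded by the same integer
  contains a ball, and boundedness on a ball is boundedness in norm.\<close>

lemma uniform_boundedness:
  fixes F :: "nat \<Rightarrow> 'a::banach \<Rightarrow>\<^sub>L 'b::real_normed_vector"
  assumes pw: "\<And>x. \<exists>c. \<forall>n. norm (F n x) \<le> c"
  shows "\<exists>c. \<forall>n. norm (F n) \<le> c"
proof -
  define E where "E k = {x. \<forall>n. norm (F n x) \<le> real k}" for k :: nat
  have cl: "closed (E k)" for k
  proof -
    have "E k = (\<Inter>n. {x. norm (F n x) \<le> real k})" unfolding E_def by auto
    moreover have "closed {x. norm (F n x) \<le> real k}" for n
      by (intro closed_Collect_le continuous_intros)
    ultimately show ?thesis by auto
  qed
  have "\<exists>k. interior (E k) \<noteq> {}"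
  proof (rule ccontr)
    assume "\<not> (\<exists>k. interior (E k) \<noteq> {})"
    then have emp: "interior (E k) = {}" for k by blast
    have "interior (\<Union>(range E)) = {}"
      using Met_TC.metric_Baire_category_alt[of "range E"] cl emp
      by (auto simp: complete_UNIV)
    moreover have "\<Union>(range E) = UNIV"
    proof -
      have "\<exists>k. x \<in> E k" for x
      proof -
        obtain c where "\<forall>n. norm (F n x) \<le> c" using pw by blast
        moreover obtain k :: nat where "c \<le> real k" using real_arch_simple by blast
        ultimately show ?thesis unfolding E_def by (auto intro: order_trans)
      qed
      then show ?thesis by auto
    qed
    ultimately show False by simp
  qed
  then obtain k x where "x \<in> interior (E k)" by blast
  then obtain r where r: "r > 0" "cball x r \<subseteq> E k"
    using mem_interior_cball by blast
  have "norm (F n) \<le> 2 * real k / r" for n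
  proof (rule norm_blinfun_bound)
    show "0 \<le> 2 * real k / r" using r by simp
    fix y
    show "norm (F n y) \<le> 2 * real k / r * norm y"
    proof (cases "y = 0")
      case False
      define w where "w = (r / norm y) *\<^sub>R y"
      have "norm w = r" using False r unfolding w_def by simp
      then have "x + w \<in> E k" "x \<in> E k" using r by (auto intro!: subsetD[OF r(2)] simp: dist_norm)
      then have "norm (F n (x + w)) \<le> real k" "norm (F n x) \<le> real k" unfolding E_def by auto
      then have "norm (F n (x + w) - F n x) \<le> 2 * real k"
        using norm_triangle_ineq4[of "F n (x + w)" "F n x"] by linarith
      then have "norm (F n w) \<le> 2 * real k" by (simp add: blinfun.bilinear_simps)
      moreover have "norm (F n w) = r / norm y * norm (F n y)"
        unfolding w_def using r by (simp add: blinfun.bilinear_simps)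
      ultimately show ?thesis using False r by (simp add: field_simps)
    qed (simp add: blinfun.bilinear_simps)
  qed
  then show ?thesis by blast
qed

text \<open>The defect \<open>g x - x * g 1\<close> is additive and vanishes on the integers, so that it is bounded on the
  whole line by its bound on the unit interval; a bounded additive function is zero.\<close>

lemma additive_bounded_imp_homogeneous:
  fixes g :: "real \<Rightarrow> real"
  assumes add: "\<And>x y. g (x + y) = g x + g y"
    and bd: "\<And>x. \<bar>x\<bar> \<le> 1 \<Longrightarrow> \<bar>g x\<bar> \<le> c"
  shows "g x = x * g 1"
proof -
  define d where "d x = g x - x * g 1" for x
  have dadd: "d (x + y) = d x + d y" for x y
    unfolding d_def by (simp add: add algebra_simps)
  have dn: "d (real n * x) = real n * d x" for n x
  proof (induction n)
    case 0
    show ?case using dadd[of 0 0] by simp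
  next
    case (Suc n)
    then show ?case using dadd[of "real n * x" x] by (simp add: algebra_simps)
  qed
  have d1: "d 1 = 0" unfolding d_def by simp
  have dneg: "d (- x) = - d x" for x using dadd[of x "- x"] dn[of 0 0] by simp
  have dint: "d (of_int k) = 0" for k
    using dn[of "nat \<bar>k\<bar>" 1] dneg[of "of_int k"] d1 by (cases "k \<ge> 0") auto
  have bound: "\<bar>d x\<bar> \<le> c + \<bar>g 1\<bar>" for x
  proof -
    have "d x = d (frac x)" using dadd[of "of_int \<lfloor>x\<rfloor>" "frac x"] dint by (simp add: frac_def)
    moreover have "\<bar>g (frac x)\<bar> \<le> c"
      using frac_ge_0[of x] frac_lt_1[of x] by (intro bd) auto
    moreover have "\<bar>frac x * g 1\<bar> \<le> \<bar>g 1\<bar>"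
      using frac_ge_0[of x] frac_lt_1[of x] by (simp add: abs_mult mult_left_le_one_le)
    ultimately show ?thesis unfolding d_def by linarith
  qed
  have "d x = 0"
  proof (rule ccontr)
    assume "d x \<noteq> 0"
    then obtain n :: nat where "c + \<bar>g 1\<bar> < real n * \<bar>d x\<bar>"
      using reals_Archimedean3[of "\<bar>d x\<bar>"] by auto
    moreover have "\<bar>d (real n * x)\<bar> = real n * \<bar>d x\<bar>" by (simp add: dn abs_mult)
    ultimately show False using bound[of "real n * x"] by simp
  qed
  then show ?thesis unfolding d_def by simp
qed

text \<open>Polarization. Real homogeneity usually comes from continuity; here the quadratic bound on \<open>V\<close>
  replaces it, and also makes the form bounded.\<close>

lemma Jordan_von_Neumann:
  fixes V :: "'a::real_normed_vector \<Rightarrow> real"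
  assumes nonneg: "\<And>x. 0 \<le> V x" and bd: "\<And>x. V x \<le> C * (norm x)\<^sup>2"
    and par: "\<And>x y. V (x + y) + V (x - y) = 2 * V x + 2 * V y"
  shows "\<exists>b. bounded_bilinear b \<and> (\<forall>x y. b x y = b y x) \<and> (\<forall>x. b x x = V x)"
proof -
  define b where "b x y = (V (x + y) - V (x - y)) / 4" for x y
  have V0: "V 0 = 0" using nonneg[of 0] bd[of 0] by simp
  have even: "V (- x) = V x" for x using par[of 0 x] V0 by simp
  have sym: "b x y = b y x" for x y
    unfolding b_def using even[of "x - y"] by (simp add: add.commute)
  have b0: "b 0 z = 0" for z unfolding b_def by (simp add: even)
  have half: "b x z + b y z = b (x + y) (2 *\<^sub>R z) / 2" for x y z
  proof -
    have "V (x + y + 2 *\<^sub>R z) + V (x - y) = 2 * V (x + z) + 2 * V (y + z)"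
      using par[of "x + z" "y + z"] by (simp add: algebra_simps scaleR_2)
    moreover have "V (x + y - 2 *\<^sub>R z) + V (x - y) = 2 * V (x - z) + 2 * V (y - z)"
      using par[of "x - z" "y - z"] by (simp add: algebra_simps scaleR_2)
    ultimately show ?thesis unfolding b_def by argo
  qed
  have add: "b (x + y) z = b x z + b y z" for x y z
    using half[of x z y] half[of "x + y" z 0] by (simp add: b0)
  have bd1: "\<bar>b x y\<bar> \<le> \<bar>C\<bar> * (norm x + norm y)\<^sup>2 / 4" for x y
  proof -
    have *: "V w \<le> \<bar>C\<bar> * (norm x + norm y)\<^sup>2" if "norm w \<le> norm x + norm y" for w
    proof -
      have "V w \<le> C * (norm w)\<^sup>2" by (rule bd)
      also have "\<dots> \<le> \<bar>C\<bar> * (norm w)\<^sup>2" by (intro mult_right_mono) auto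
      also have "\<dots> \<le> \<bar>C\<bar> * (norm x + norm y)\<^sup>2"
        using that by (intro mult_left_mono power_mono) auto
      finally show ?thesis .
    qed
    have "V (x + y) \<le> \<bar>C\<bar> * (norm x + norm y)\<^sup>2" "V (x - y) \<le> \<bar>C\<bar> * (norm x + norm y)\<^sup>2"
      by (auto intro!: * norm_triangle_ineq norm_triangle_ineq4)
    then show ?thesis unfolding b_def using nonneg[of "x + y"] nonneg[of "x - y"] by simp
  qed
  have scale: "b (r *\<^sub>R x) z = r * b x z" for r x z
  proof -
    have "b (r *\<^sub>R x) z = r * b (1 *\<^sub>R x) z"
    proof (rule additive_bounded_imp_homogeneous)
      show "b ((s + t) *\<^sub>R x) z = b (s *\<^sub>R x) z + b (t *\<^sub>R x) z" for s t
        by (simp add: scaleR_add_left add)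
      show "\<bar>b (s *\<^sub>R x) z\<bar> \<le> \<bar>C\<bar> * (norm x + norm z)\<^sup>2 / 4" if "\<bar>s\<bar> \<le> 1" for s
      proof -
        have "norm (s *\<^sub>R x) \<le> norm x" using that by (simp add: mult_left_le_one_le)
        then have "\<bar>C\<bar> * (norm (s *\<^sub>R x) + norm z)\<^sup>2 / 4 \<le> \<bar>C\<bar> * (norm x + norm z)\<^sup>2 / 4"
          by (intro divide_right_mono mult_left_mono power_mono) auto
        then show ?thesis using bd1[of "s *\<^sub>R x" z] by linarith
      qed
    qed
    then show ?thesis by simp
  qed
  have scale2: "b x (r *\<^sub>R z) = r * b x z" for r x z
    using scale[of r z x] by (simp add: sym)
  have "bounded_bilinear b"
  proof
    show "b (x + y) z = b x z + b y z" "b (r *\<^sub>R x) z = r *\<^sub>R b x z" for x y z r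
      by (simp_all add: add scale)
    show "b x (y + z) = b x y + b x z" "b x (r *\<^sub>R z) = r *\<^sub>R b x z" for x y z r
      by (simp_all add: sym[of x] add scale)
    have "norm (b x y) \<le> norm x * norm y * \<bar>C\<bar>" for x y
    proof (cases "x = 0 \<or> y = 0")
      case True
      then show ?thesis using b0[of y] b0[of x] sym[of x 0] by auto
    next
      case False
      have "b x y = norm x * norm y * b (x /\<^sub>R norm x) (y /\<^sub>R norm y)"
        using False by (simp add: scale scale2) (simp add: field_simps)
      moreover have "\<bar>b (x /\<^sub>R norm x) (y /\<^sub>R norm y)\<bar> \<le> \<bar>C\<bar>"
        using bd1[of "x /\<^sub>R norm x" "y /\<^sub>R norm y"] False by simp
      ultimately show ?thesis by (simp add: abs_mult mult_left_mono)
    qed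
    then show "\<exists>K. \<forall>x y. norm (b x y) \<le> norm x * norm y * K" by blast
  qed
  moreover have "b x x = V x" for x
    using par[of x x] V0 unfolding b_def by simp
  ultimately show ?thesis using sym by (intro exI[of _ b]) simp
qed

section \<open>Two facts about real functions\<close>

text \<open>A Gronwall bound whose constants are not sharp: at the maximum of \<open>\<phi> t * exp (- 2 * c * t)\<close> the
  integral term accounts for at most half of the value.\<close>

lemma weak_gronwall:
  fixes \<phi> :: "real \<Rightarrow> real"
  assumes cont: "continuous_on {0..T} \<phi>" and c: "0 \<le> c" and a: "0 \<le> a"
    and nn: "\<And>t. t \<in> {0..T} \<Longrightarrow> 0 \<le> \<phi> t"
    and le: "\<And>t. t \<in> {0..T} \<Longrightarrow> \<phi> t \<le> a + c * integral {0..t} \<phi>"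
    and t: "t \<in> {0..T}"
  shows "\<phi> t \<le> 2 * a * exp (2 * c * t)"
proof (cases "c = 0")
  case True
  then show ?thesis using le[OF t] a by auto
next
  case False
  with c have c: "0 < c" by simp
  define \<psi> where "\<psi> t = \<phi> t * exp (- (2 * c * t))" for t
  have "continuous_on {0..T} \<psi>"
    unfolding \<psi>_def by (intro continuous_intros cont)
  then obtain m where m: "m \<in> {0..T}" "\<And>s. s \<in> {0..T} \<Longrightarrow> \<psi> s \<le> \<psi> m"
    using continuous_attains_sup[of "{0..T}" \<psi>] t by auto
  define A where "A = \<psi> m"
  have phi_le: "\<phi> s \<le> A * exp (2 * c * s)" if "s \<in> {0..T}" for s
    using m(2)[OF that] unfolding \<psi>_def A_def by (simp add: exp_minus field_simps)
  have phi_m: "\<phi> m = A * exp (2 * c * m)" unfolding A_def \<psi>_def by (simp add: exp_minus)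
  have A0: "0 \<le> A" unfolding A_def \<psi>_def using nn[OF m(1)] by simp
  have hi: "((\<lambda>s. A * exp (2 * c * s)) has_integral
      (A * exp (2 * c * m) / (2 * c) - A * exp (2 * c * 0) / (2 * c))) {0..m}"
    using m(1) c by (intro fundamental_theorem_of_calculus)
      (auto intro!: derivative_eq_intros simp flip: has_real_derivative_iff_has_vector_derivative)
  have "integral {0..m} \<phi> \<le> A * exp (2 * c * m) / (2 * c) - A * exp (2 * c * 0) / (2 * c)"
  proof (rule has_integral_le[OF integrable_integral hi])
    show "\<phi> integrable_on {0..m}"
      using m(1) by (intro integrable_continuous_interval continuous_on_subset[OF cont]) auto
  qed (use m(1) phi_le in auto)
  also have "\<dots> \<le> A * exp (2 * c * m) / (2 * c)" using A0 c by simp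
  finally have "c * integral {0..m} \<phi> \<le> A * exp (2 * c * m) / 2" using c by (simp add: field_simps)
  with le[OF m(1)] phi_m have "A * exp (2 * c * m) \<le> 2 * a" by simp
  moreover have "A * 1 \<le> A * exp (2 * c * m)"
    using A0 c m(1) by (intro mult_left_mono) auto
  ultimately have "A \<le> 2 * a" by simp
  then have "A * exp (2 * c * t) \<le> 2 * a * exp (2 * c * t)" by (intro mult_right_mono) auto
  then show ?thesis using phi_le[OF t] by linarith
qed

text \<open>Along closed-loop orbits only the upper right derivative of the optimal cost is estimated; for a
  continuous function its sign decides monotonicity.\<close>

lemma nonincreasing_if_right_derivative_nonpos:
  fixes \<phi> :: "real \<Rightarrow> real"
  assumes cont: "continuous_on {0..t} \<phi>"
    and der: "\<And>t e. 0 \<le> t \<Longrightarrow> 0 < e \<Longrightarrow> \<exists>d>0. \<forall>r\<in>{0<..<d}. \<phi> (t + r) \<le> \<phi> t + e * r"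
    and t: "0 \<le> t"
  shows "\<phi> t \<le> \<phi> 0"
proof -
  have *: "\<phi> t \<le> \<phi> 0 + e * t" if e: "0 < e" for e
  proof -
    define A where "A = {s \<in> {0..t}. \<phi> s \<le> \<phi> 0 + e * s}"
    define m where "m = Sup A"
    have "A = {0..t} \<inter> (\<lambda>s. \<phi> s - (\<phi> 0 + e * s)) -` {..0}" unfolding A_def by auto
    moreover have "continuous_on {0..t} (\<lambda>s. \<phi> s - (\<phi> 0 + e * s))"
      by (intro continuous_intros cont)
    ultimately have "closed A"
      using continuous_closed_preimage[of "{0..t}" "\<lambda>s. \<phi> s - (\<phi> 0 + e * s)" "{..0}"]
      by simp
    moreover have ne: "0 \<in> A" unfolding A_def using t by auto
    moreover have bdd: "bdd_above A" unfolding A_def by (auto intro!: bdd_aboveI[of _ t])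
    ultimately have mA: "m \<in> A" unfolding m_def using closed_contains_Sup by blast
    have "m = t"
    proof (rule ccontr)
      assume "m \<noteq> t"
      then have m: "0 \<le> m" "m < t" using mA unfolding A_def by auto
      obtain d where d: "d > 0" "\<And>r. r \<in> {0<..<d} \<Longrightarrow> \<phi> (m + r) \<le> \<phi> m + e * r"
        using der[OF m(1) e] by blast
      define r where "r = min (d / 2) (t - m)"
      have r: "0 < r" "r < d" "m + r \<le> t" using d(1) m(2) unfolding r_def by auto
      have "\<phi> (m + r) \<le> \<phi> 0 + e * (m + r)"
        using d(2)[of r] r mA unfolding A_def by (auto simp: algebra_simps)
      then have "m + r \<in> A" unfolding A_def using r m by auto
      then have "m + r \<le> m" unfolding m_def using bdd cSup_upper by blast
      then show False using r by simp
    qed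
    then show ?thesis using mA unfolding A_def by simp
  qed
  show ?thesis
  proof (rule field_le_epsilon)
    fix e :: real assume e: "0 < e"
    have "\<phi> t \<le> \<phi> 0 + e / (t + 1) * t" using t e by (intro *) auto
    also have "e / (t + 1) * t \<le> e" using t e by (simp add: field_simps)
    finally show "\<phi> t \<le> \<phi> 0 + e" by simp
  qed
qed

section \<open>Strongly continuous semigroups\<close>

locale C0_sg =
  fixes S :: "real \<Rightarrow> 'h::banach \<Rightarrow>\<^sub>L 'h"
  assumes C0: "C0_semigroup S"
begin

lemma S_zero [simp]: "S 0 x = x"
  using C0 unfolding C0_semigroup_def by simp

lemma S_add: "0 \<le> s \<Longrightarrow> 0 \<le> t \<Longrightarrow> S (s + t) x = S s (S t x)"
  using C0 unfolding C0_semigroup_def by simp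

lemma S_right_continuous: "((\<lambda>t. S t x) \<longlongrightarrow> x) (at_right 0)"
  using C0 unfolding C0_semigroup_def by simp

lemma S_continuous_at_zero: "0 < e \<Longrightarrow> \<exists>d>0. \<forall>t\<in>{0..<d}. norm (S t x - x) < e"
proof -
  assume e: "0 < e"
  have "\<forall>\<^sub>F t in at_right 0. dist (S t x) x < e"
    using S_right_continuous[of x] e tendstoD by blast
  then obtain d where d: "d > 0" "\<And>t. 0 < t \<Longrightarrow> t < d \<Longrightarrow> dist (S t x) x < e"
    unfolding eventually_at_right_field by auto
  have "norm (S t x - x) < e" if "t \<in> {0..<d}" for t
    using d(2)[of t] that e by (cases "t = 0") (auto simp: dist_norm)
  with d(1) show ?thesis by blast
qed

text \<open>Otherwise there would be times \<open>t n\<close> tending to zero with \<open>norm (S (t n)) > n\<close>, while every orbit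
  \<open>S (t n) x\<close> converges.\<close>

lemma S_bounded_near_zero: "\<exists>d>0. \<exists>c. \<forall>t\<in>{0..d}. norm (S t) \<le> c"
proof (rule ccontr)
  assume "\<not> ?thesis"
  then have no: "\<not> (\<forall>t\<in>{0..d}. norm (S t) \<le> c)" if "0 < d" for d c
    using that by blast
  have "\<exists>t\<in>{0..1 / real (Suc n)}. \<not> norm (S t) \<le> real n" for n
    using no[of "1 / real (Suc n)" "real n"] by auto
  then obtain t where t: "\<And>n. t n \<in> {0..1 / real (Suc n)}" "\<And>n. \<not> norm (S (t n)) \<le> real n"
    by metis
  have "\<exists>c. \<forall>n. norm (S (t n) x) \<le> c" for x
  proof -
    obtain d where d: "d > 0" "\<And>s. s \<in> {0..<d} \<Longrightarrow> norm (S s x - x) < 1"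
      using S_continuous_at_zero[of 1 x] by auto
    obtain N :: nat where N: "1 / d < real N" using reals_Archimedean2 by blast
    have "norm (S (t n) x) \<le> (\<Sum>k<N. norm (S (t k) x)) + (norm x + 1)" for n
    proof (cases "n < N")
      case True
      then have "norm (S (t n) x) \<le> (\<Sum>k<N. norm (S (t k) x))"
        by (intro member_le_sum[of n "{..<N}" "\<lambda>k. norm (S (t k) x)"]) auto
      moreover have "0 \<le> norm x + 1" by simp
      ultimately show ?thesis by linarith
    next
      case False
      then have "1 / d < real (Suc n)" using N by simp
      then have "1 / real (Suc n) < d" using d(1) by (simp add: field_simps)
      then have "norm (S (t n) x - x) < 1" using t(1)[of n] by (intro d) auto
      then have "norm (S (t n) x) \<le> norm x + 1"
        using norm_triangle_ineq2[of "S (t n) x" x] by simp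
      moreover have "0 \<le> (\<Sum>k<N. norm (S (t k) x))" by (intro sum_nonneg) auto
      ultimately show ?thesis by linarith
    qed
    then show ?thesis by blast
  qed
  then obtain c where c: "\<And>n. norm (S (t n)) \<le> c"
    using uniform_boundedness[of "\<lambda>n. S (t n)"] by blast
  obtain n :: nat where "c \<le> real n" using real_arch_simple by blast
  then show False using t(2)[of n] c[of n] by linarith
qed

lemma S_locally_bounded:
  obtains M where "1 \<le> M" "\<And>t x. t \<in> {0..T} \<Longrightarrow> norm (S t x) \<le> M * norm x"
proof -
  obtain d c where d: "d > 0" and c: "\<And>t. t \<in> {0..d} \<Longrightarrow> norm (S t) \<le> c"
    using S_bounded_near_zero by blast
  define c' where "c' = max 1 c"
  have cc: "norm (S t) \<le> c'" "1 \<le> c'" if "t \<in> {0..d}" for t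
    using c[OF that] unfolding c'_def by auto
  have c1: "1 \<le> c'" unfolding c'_def by simp
  have *: "norm (S t) \<le> c' ^ (Suc n)" if "0 \<le> t" "t \<le> real (Suc n) * d" for n t
    using that
  proof (induction n arbitrary: t)
    case 0
    then show ?case using cc[of t] by simp
  next
    case (Suc n)
    show ?case
    proof (cases "t \<le> d")
      case True
      then have "norm (S t) \<le> c' ^ 1" using cc[of t] Suc.prems by simp
      also have "\<dots> \<le> c' ^ Suc (Suc n)" using c1 by (intro power_increasing) auto
      finally show ?thesis .
    next
      case False
      have "S t = S d o\<^sub>L S (t - d)"
        using S_add[of d "t - d"] d False by (intro blinfun_eqI) simp
      then have "norm (S t) \<le> norm (S d) * norm (S (t - d))"
        using norm_blinfun_compose by metis
      also have "\<dots> \<le> c' * c' ^ (Suc n)"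
        using d False Suc.prems cc[of d] c1
        by (intro mult_mono Suc.IH) (auto simp: algebra_simps)
      finally show ?thesis by simp
    qed
  qed
  obtain n :: nat where n0: "T / d \<le> real n" using real_arch_simple by blast
  have "T = T / d * d" using d by simp
  also have "\<dots> \<le> real (Suc n) * d" using n0 d by (intro mult_right_mono) auto
  finally have n: "T \<le> real (Suc n) * d" .
  show ?thesis
  proof
    show "1 \<le> c' ^ Suc n" using c1 by (rule one_le_power)
    fix t x assume "t \<in> {0..T}"
    then have "norm (S t) \<le> c' ^ Suc n" using n by (intro *) auto
    then show "norm (S t x) \<le> c' ^ Suc n * norm x"
      by (meson mult_right_mono norm_blinfun norm_ge_zero order_trans)
  qed
qed

lemma S_orbit_continuous: "continuous_on {0..} (\<lambda>t. S t x)"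
proof (rule continuous_onI)
  fix t e :: real assume t: "t \<in> {0..}" and e: "0 < e"
  obtain M where M: "1 \<le> M" "\<And>s y. s \<in> {0..t + 1} \<Longrightarrow> norm (S s y) \<le> M * norm y"
    using S_locally_bounded[of "t + 1"] by blast
  obtain d where d: "d > 0" "\<And>s. s \<in> {0..<d} \<Longrightarrow> norm (S s x - x) < e / M"
    using S_continuous_at_zero[of "e / M" x] e M(1) by auto
  have *: "norm (S (a + r) x - S a x) < e" if "0 \<le> a" "a \<le> t + 1" "0 \<le> r" "r < d" for a r
  proof -
    have "S (a + r) x - S a x = S a (S r x - x)"
      using that by (simp add: S_add blinfun.bilinear_simps)
    then have "norm (S (a + r) x - S a x) \<le> M * norm (S r x - x)" using that M(2) by simp
    also have "\<dots> < M * (e / M)" using M(1) d(2)[of r] that by (intro mult_strict_left_mono) auto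
    finally show ?thesis using M(1) by simp
  qed
  have "dist (S s x) (S t x) \<le> e" if "s \<in> {0..}" "dist s t < min d 1" for s
  proof (cases "s \<le> t")
    case True
    then show ?thesis using *[of s "t - s"] that by (auto simp: dist_norm norm_minus_commute)
  next
    case False
    then show ?thesis using *[of t "s - t"] that t by (auto simp: dist_norm)
  qed
  then show "\<exists>d>0. \<forall>s\<in>{0..}. dist s t < d \<longrightarrow> dist (S s x) (S t x) \<le> e"
    using d(1) by (intro exI[of _ "min d 1"]) auto
qed

lemma S_jointly_continuous:
  assumes f: "continuous_on X f" and g: "continuous_on X g" and nn: "\<And>p. p \<in> X \<Longrightarrow> 0 \<le> f p"
  shows "continuous_on X (\<lambda>p. S (f p) (g p))"
proof -
  have "((\<lambda>p. S (f p) (g p)) \<longlongrightarrow> S (f q) (g q)) (at q within X)" if q: "q \<in> X" for q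
  proof -
    have fl: "(f \<longlongrightarrow> f q) (at q within X)" and gl: "(g \<longlongrightarrow> g q) (at q within X)"
      using f g q by (auto simp: continuous_on_def)
    obtain M where M: "1 \<le> M" "\<And>s y. s \<in> {0..f q + 1} \<Longrightarrow> norm (S s y) \<le> M * norm y"
      using S_locally_bounded[of "f q + 1"] by blast
    have "continuous_on X (\<lambda>p. S (f p) (g q))"
      using continuous_on_compose2[OF S_orbit_continuous[of "g q"] f] nn by auto
    then have 1: "((\<lambda>p. S (f p) (g q)) \<longlongrightarrow> S (f q) (g q)) (at q within X)"
      using q by (auto simp: continuous_on_def)
    have "((\<lambda>p. S (f p) (g p - g q)) \<longlongrightarrow> 0) (at q within X)"
    proof (rule Lim_null_comparison)
      have "\<forall>\<^sub>F p in at q within X. dist (f p) (f q) < 1" using tendstoD[OF fl] by simp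
      moreover have "\<forall>\<^sub>F p in at q within X. p \<in> X" by (simp add: eventually_at_filter)
      ultimately show "\<forall>\<^sub>F p in at q within X. norm (S (f p) (g p - g q)) \<le> M * norm (g p - g q)"
        by eventually_elim (use nn in \<open>auto intro!: M(2) simp: dist_real_def\<close>)
      have "((\<lambda>p. M * norm (g p - g q)) \<longlongrightarrow> M * norm (g q - g q)) (at q within X)"
        by (intro tendsto_intros gl)
      then show "((\<lambda>p. M * norm (g p - g q)) \<longlongrightarrow> 0) (at q within X)" by simp
    qed
    from tendsto_add[OF this 1] show ?thesis by (simp add: blinfun.bilinear_simps)
  qed
  then show ?thesis by (auto simp: continuous_on_def)
qed

lemma convolution_integrand_continuous:
  assumes "continuous_on {0..t} w"
  shows "continuous_on {0..t} (\<lambda>s. S (t - s) (w s))"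
  by (intro S_jointly_continuous continuous_intros assms) auto

text \<open>Rescaling the integral to the unit interval moves \<open>t\<close> from the limits of integration into a jointly
  continuous integrand.\<close>

lemma convolution_continuous:
  assumes w: "continuous_on {0..} w"
  shows "continuous_on {0..} (\<lambda>t. integral {0..t} (\<lambda>s. S (t - s) (w s)))"
proof -
  have eq: "integral {0..t} (\<lambda>s. S (t - s) (w s)) =
      integral (cbox 0 1) (\<lambda>r. t *\<^sub>R S (t - t * r) (w (t * r)))" if t: "0 \<le> t" for t
  proof (cases "t = 0")
    case False
    with t have t: "0 < t" by simp
    have "(\<lambda>s. S (t - s) (w s)) integrable_on {0..t}"
      using w by (intro integrable_continuous_interval convolution_integrand_continuous)
        (auto intro: continuous_on_subset)
    then have "((\<lambda>s. S (t - s) (w s)) has_integral integral {0..t} (\<lambda>s. S (t - s) (w s))) {0..t}"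
      by (rule integrable_integral)
    from has_integral_cmul[OF has_integral_stretch_real[OF this, of t], of t] t
    have "((\<lambda>r. t *\<^sub>R S (t - t * r) (w (t * r))) has_integral
        integral {0..t} (\<lambda>s. S (t - s) (w s))) ((\<lambda>x. x / t) ` {0..t})" by simp
    moreover have "(\<lambda>x. x / t) ` {0..t} = cbox 0 1"
    proof -
      have "x \<in> (\<lambda>x. x / t) ` {0..t}" if "0 \<le> x" "x \<le> 1" for x
        using that t by (intro image_eqI[of _ _ "x * t"]) (auto simp: mult_left_le_one_le)
      then show ?thesis using t by (auto simp: field_simps)
    qed
    ultimately have "((\<lambda>r. t *\<^sub>R S (t - t * r) (w (t * r))) has_integral
        integral {0..t} (\<lambda>s. S (t - s) (w s))) (cbox 0 1)" by (simp only:)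
    then show ?thesis by (rule integral_unique[symmetric])
  qed simp
  have "continuous_on {0..} (\<lambda>t. integral (cbox 0 1) (\<lambda>r. t *\<^sub>R S (t - t * r) (w (t * r))))"
  proof (rule integral_continuous_on_param)
    have "continuous_on ({0..} \<times> cbox 0 1) (\<lambda>p. fst p *\<^sub>R S (fst p - fst p * snd p) (w (fst p * snd p)))"
    proof (rule continuous_on_scaleR, rule continuous_on_fst[OF continuous_on_id],
        rule S_jointly_continuous)
      show "continuous_on ({0..} \<times> cbox 0 1) (\<lambda>p :: real \<times> real. fst p - fst p * snd p)"
        by (intro continuous_intros)
      have "continuous_on ({0..} \<times> cbox 0 1) (\<lambda>p :: real \<times> real. fst p * snd p)"
        by (intro continuous_intros)
      then show "continuous_on ({0..} \<times> cbox 0 1) (\<lambda>p. w (fst p * snd p))"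
        by (rule continuous_on_compose2[OF w]) auto
      show "0 \<le> fst p - fst p * snd p" if "p \<in> {0..} \<times> cbox 0 1" for p :: "real \<times> real"
        using that by (auto simp: mult_left_le)
    qed
    then show "continuous_on ({0..} \<times> cbox 0 1) (\<lambda>(t, r). t *\<^sub>R S (t - t * r) (w (t * r)))"
      by (simp add: case_prod_beta)
  qed
  then show ?thesis by (rule continuous_on_eq) (simp add: eq)
qed

text \<open>The state \<open>y r\<close> is a legitimate new initial value: the semigroup law carries the part of the
  variation-of-constants integral over \<open>{0..r}\<close> along.\<close>

lemma mild_restart:
  assumes m: "\<And>t. 0 \<le> t \<Longrightarrow> ((\<lambda>s. S (t - s) (w s)) has_integral (y t - S t h)) {0..t}"
    and r: "0 \<le> r" and t: "0 \<le> t"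
  shows "((\<lambda>s. S (t - s) (w (r + s))) has_integral (y (r + t) - S t (y r))) {0..t}"
proof -
  let ?g = "\<lambda>s. S (r + t - s) (w s)"
  have "((\<lambda>s. S t (S (r - s) (w s))) has_integral S t (y r - S r h)) {0..r}"
    using has_integral_linear[OF m[OF r] blinfun.bounded_linear_right[of "S t"]] by (simp add: o_def)
  moreover have "S t (S (r - s) (w s)) = ?g s" if "s \<in> {0..r}" for s
    using that t S_add[of t "r - s"] by (simp add: algebra_simps)
  ultimately have 1: "(?g has_integral S t (y r - S r h)) {0..r}"
    by (rule has_integral_eq[rotated])
  have 2: "(?g has_integral (y (r + t) - S (r + t) h)) {0..r + t}" using m[of "r + t"] r t by simp
  have "?g integrable_on {r..r + t}"
    using 2 r t integrable_subinterval_real[OF has_integral_integrable[OF 2]] by auto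
  then obtain I where I: "(?g has_integral I) {r..r + t}" by blast
  have "(?g has_integral (S t (y r - S r h) + I)) {0..r + t}"
    using has_integral_combine[OF _ _ 1 I] r t by simp
  then have "I = y (r + t) - S (r + t) h - S t (y r - S r h)"
    using has_integral_unique[OF 2] by (simp add: algebra_simps)
  also have "\<dots> = y (r + t) - S t (y r)"
    using S_add[OF t r] by (simp add: blinfun.bilinear_simps add.commute)
  finally have "(?g has_integral (y (r + t) - S t (y r))) {r..r + t}" using I by simp
  from has_integral_shift_real_ivl[OF this, of r] show ?thesis by (simp add: algebra_simps)
qed

section \<open>Bounded perturbations\<close>

text \<open>The orbits of the semigroup whose generator is that of \<open>S\<close> plus \<open>F\<close>. They are the mild solutions of
  the closed loop with constant feedback \<open>K\<close> when \<open>F = D o\<^sub>L K - B\<close>.\<close>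

definition perturbed_orbit :: "('h \<Rightarrow>\<^sub>L 'h) \<Rightarrow> 'h \<Rightarrow> (real \<Rightarrow> 'h) \<Rightarrow> bool" where
  "perturbed_orbit F h y \<longleftrightarrow> continuous_on {0..} y \<and>
     (\<forall>t\<ge>0. ((\<lambda>s. S (t - s) (F (y s))) has_integral (y t - S t h)) {0..t})"

lemma perturbed_orbit_bound:
  shows "\<exists>C. \<forall>h y. perturbed_orbit F h y \<longrightarrow> (\<forall>t\<in>{0..T}. norm (y t) \<le> C * norm h)"
proof -
  obtain M where M: "1 \<le> M" "\<And>t x. t \<in> {0..T} \<Longrightarrow> norm (S t x) \<le> M * norm x"
    using S_locally_bounded[of T] by blast
  define c where "c = M * norm F"
  have c0: "0 \<le> c" unfolding c_def using M(1) by simp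
  have "norm (y t) \<le> 2 * M * exp (2 * c * T) * norm h"
    if y: "perturbed_orbit F h y" and t: "t \<in> {0..T}" for h y t
  proof -
    have cont: "continuous_on {0..} y" using y unfolding perturbed_orbit_def by blast
    then have contn: "continuous_on {0..r} (\<lambda>s. norm (y s))" for r
      by (intro continuous_intros continuous_on_subset[OF cont]) auto
    have "norm (y t) \<le> 2 * (M * norm h) * exp (2 * c * t)"
    proof (rule weak_gronwall[OF contn c0 _ _ _ t])
      fix r assume r: "r \<in> {0..T}"
      have hi: "((\<lambda>s. S (r - s) (F (y s))) has_integral (y r - S r h)) {0..r}"
        using y r unfolding perturbed_orbit_def by simp
      have "norm (y r - S r h) \<le> integral {0..r} (\<lambda>s. c * norm (y s))"
        unfolding integral_unique[OF hi, symmetric]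
      proof (rule integral_norm_bound_integral)
        show "(\<lambda>s. S (r - s) (F (y s))) integrable_on {0..r}" using hi by blast
        show "(\<lambda>s. c * norm (y s)) integrable_on {0..r}"
          by (intro integrable_continuous_interval continuous_intros contn)
        fix s assume s: "s \<in> {0..r}"
        have "norm (S (r - s) (F (y s))) \<le> M * norm (F (y s))" using s r by (intro M) auto
        also have "\<dots> \<le> M * (norm F * norm (y s))"
          using M(1) by (intro mult_left_mono norm_blinfun) auto
        finally show "norm (S (r - s) (F (y s))) \<le> c * norm (y s)" unfolding c_def by simp
      qed
      then have "norm (y r) \<le> norm (S r h) + c * integral {0..r} (\<lambda>s. norm (y s))"
        using norm_triangle_ineq2[of "y r" "S r h"] by simp
      then show "norm (y r) \<le> M * norm h + c * integral {0..r} (\<lambda>s. norm (y s))"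
        using M(2)[OF r, of h] by linarith
    qed (use M(1) in auto)
    also have "\<dots> \<le> 2 * (M * norm h) * exp (2 * c * T)"
      using t c0 M(1) by (intro mult_left_mono) (auto intro!: mult_left_mono)
    finally show ?thesis by (simp add: mult_ac)
  qed
  then show ?thesis by blast
qed

lemma perturbed_orbit_unique:
  assumes "perturbed_orbit F h y" "perturbed_orbit F h z" "0 \<le> t"
  shows "y t = z t"
proof -
  have "((\<lambda>s. S (r - s) (F (y s - z s))) has_integral (y r - z r - S r 0)) {0..r}" if "0 \<le> r" for r
  proof -
    have "((\<lambda>s. S (r - s) (F (y s)) - S (r - s) (F (z s))) has_integral
        ((y r - S r h) - (z r - S r h))) {0..r}"
      using assms(1,2) that unfolding perturbed_orbit_def by (intro has_integral_diff) auto
    then show ?thesis by (simp add: blinfun.bilinear_simps)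
  qed
  then have 0: "perturbed_orbit F 0 (\<lambda>t. y t - z t)"
    using assms unfolding perturbed_orbit_def by (auto intro!: continuous_intros)
  obtain C where C: "\<forall>h y. perturbed_orbit F h y \<longrightarrow> (\<forall>s\<in>{0..t}. norm (y s) \<le> C * norm h)"
    using perturbed_orbit_bound by blast
  have "norm (y t - z t) \<le> C * norm (0 :: 'h)" using C[rule_format, OF 0, of t] assms(3) by simp
  then show ?thesis by simp
qed

text \<open>The Picard iterates \<open>Y n\<close> are summed; the sum converges uniformly on every bounded interval.\<close>

lemma perturbed_orbit_exists: "\<exists>y. perturbed_orbit F h y"
proof -
  define Y where "Y = rec_nat (\<lambda>t. S t h) (\<lambda>_ g t. integral {0..t} (\<lambda>s. S (t - s) (F (g s))))"
  have Y0: "Y 0 t = S t h" and YS: "Y (Suc n) t = integral {0..t} (\<lambda>s. S (t - s) (F (Y n s)))" for n t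
    unfolding Y_def by simp_all
  have Yc: "continuous_on {0..} (Y n)" for n
  proof (induction n)
    case 0
    show ?case using S_orbit_continuous by (simp add: Y0)
  next
    case (Suc n)
    have "continuous_on {0..} (\<lambda>s. F (Y n s))" by (intro continuous_intros Suc)
    from convolution_continuous[OF this] show ?case by (simp add: YS)
  qed
  have Yi: "continuous_on {0..t} (\<lambda>s. S (t - s) (F (Y n s)))" for n t
    by (intro convolution_integrand_continuous continuous_intros continuous_on_subset[OF Yc]) auto
  define y where "y t = (\<Sum>n. Y n t)" for t
  have unif: "uniform_limit {0..T} (\<lambda>n t. \<Sum>i<n. Y i t) y sequentially" for T
  proof -
    obtain M where M: "1 \<le> M" "\<And>t x. t \<in> {0..T} \<Longrightarrow> norm (S t x) \<le> M * norm x"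
      using S_locally_bounded[of T] by blast
    define c where "c = M * norm F + 1"
    have c: "0 < c" "M * norm F \<le> c" unfolding c_def using M(1) by (auto intro: add_nonneg_pos)
    \<comment> \<open>in the norm weighted by \<open>exp (- 2 c t)\<close> the Volterra operator contracts by \<open>1/2\<close>\<close>
    have bd: "norm (Y n t) \<le> M * norm h * (1/2) ^ n * exp (2 * c * t)" if "t \<in> {0..T}" for n t
      using that
    proof (induction n arbitrary: t)
      case 0
      have "norm (Y 0 t) \<le> M * norm h * 1" using M(2)[OF 0] by (simp add: Y0)
      also have "\<dots> \<le> M * norm h * exp (2 * c * t)"
        using M(1) c 0 by (intro mult_left_mono) auto
      finally show ?case by simp
    next
      case (Suc n)
      define A where "A = M * norm h * (1/2) ^ n"
      have A: "0 \<le> A" unfolding A_def using M(1) by simp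
      have hi: "((\<lambda>s. c * (A * exp (2 * c * s))) has_integral
          (A * exp (2 * c * t) / 2 - A * exp (2 * c * 0) / 2)) {0..t}"
        using Suc.prems by (intro fundamental_theorem_of_calculus)
          (auto intro!: derivative_eq_intros simp flip: has_real_derivative_iff_has_vector_derivative)
      have "norm (Y (Suc n) t) \<le> integral {0..t} (\<lambda>s. c * (A * exp (2 * c * s)))"
        unfolding YS
      proof (rule integral_norm_bound_integral)
        show "(\<lambda>s. S (t - s) (F (Y n s))) integrable_on {0..t}"
          by (intro integrable_continuous_interval Yi)
        show "(\<lambda>s. c * (A * exp (2 * c * s))) integrable_on {0..t}" using hi by blast
        fix s assume s: "s \<in> {0..t}"
        have "norm (S (t - s) (F (Y n s))) \<le> M * norm (F (Y n s))"
          using s Suc.prems by (intro M) auto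
        also have "\<dots> \<le> M * (norm F * norm (Y n s))"
          using M(1) by (intro mult_left_mono norm_blinfun) auto
        also have "\<dots> = (M * norm F) * norm (Y n s)" by simp
        also have "\<dots> \<le> c * (A * exp (2 * c * s))"
          using Suc.IH[of s] s Suc.prems c A M(1) unfolding A_def by (intro mult_mono) auto
        finally show "norm (S (t - s) (F (Y n s))) \<le> c * (A * exp (2 * c * s))" .
      qed
      also have "\<dots> = A * exp (2 * c * t) / 2 - A * exp (2 * c * 0) / 2"
        using hi by (rule integral_unique)
      also have "\<dots> \<le> A * exp (2 * c * t) / 2" using A by simp
      finally show ?case unfolding A_def by simp
    qed
    show ?thesis unfolding y_def
    proof (rule Weierstrass_m_test)
      show "norm (Y n t) \<le> M * norm h * exp (2 * c * T) * (1/2) ^ n" if "t \<in> {0..T}" for n t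
      proof -
        have "exp (2 * c * t) \<le> exp (2 * c * T)" using that c by simp
        then have "M * norm h * (1/2) ^ n * exp (2 * c * t) \<le> M * norm h * (1/2) ^ n * exp (2 * c * T)"
          using M(1) by (intro mult_left_mono) auto
        then show ?thesis using bd[OF that, of n] by (simp add: mult_ac)
      qed
      show "summable (\<lambda>n. M * norm h * exp (2 * c * T) * (1/2) ^ n)"
        by (intro summable_mult summable_geometric) simp
    qed
  qed
  have contT: "continuous_on {0..T} y" for T
  proof (rule uniform_limit_theorem[OF _ unif sequentially_bot])
    have "continuous_on {0..T} (\<lambda>t. \<Sum>i<n. Y i t)" for n
      by (intro continuous_intros continuous_on_subset[OF Yc]) auto
    then show "\<forall>\<^sub>F n in sequentially. continuous_on {0..T} (\<lambda>t. \<Sum>i<n. Y i t)" by simp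
  qed
  have cont: "continuous_on {0..} y"
  proof -
    have "(y \<longlongrightarrow> y t) (at t within {0..})" if t: "0 \<le> t" for t
    proof -
      have "(y \<longlongrightarrow> y t) (at t within {0..t + 1})"
        using contT[of "t + 1"] t by (auto simp: continuous_on_def)
      moreover have "at t within {0..t + 1} = at t within {0..}"
        by (rule at_within_nhd[of _ "{t - 1<..<t + 1}"]) auto
      ultimately show ?thesis by simp
    qed
    then show ?thesis by (auto simp: continuous_on_def)
  qed
  have "((\<lambda>s. S (t - s) (F (y s))) has_integral (y t - S t h)) {0..t}" if t: "0 \<le> t" for t
  proof -
    define P where "P n s = (\<Sum>i<n. Y i s)" for n s
    obtain M where M: "1 \<le> M" "\<And>r x. r \<in> {0..t} \<Longrightarrow> norm (S r x) \<le> M * norm x"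
      using S_locally_bounded[of t] by blast
    define c where "c = M * norm F + 1"
    have c: "0 < c" "M * norm F \<le> c" unfolding c_def using M(1) by (auto intro: add_nonneg_pos)
    have "uniform_limit {0..t} (\<lambda>n s. S (t - s) (F (P n s))) (\<lambda>s. S (t - s) (F (y s))) sequentially"
    proof (rule uniform_limitI)
      fix e :: real assume e: "0 < e"
      have "\<forall>\<^sub>F n in sequentially. \<forall>s\<in>{0..t}. dist (P n s) (y s) < e / c"
        using uniform_limitD[OF unif[of t], of "e / c"] e c unfolding P_def by simp
      then show "\<forall>\<^sub>F n in sequentially. \<forall>s\<in>{0..t}. dist (S (t - s) (F (P n s))) (S (t - s) (F (y s))) < e"
      proof eventually_elim
        case (elim n)
        show ?case
        proof
          fix s assume s: "s \<in> {0..t}"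
          have "dist (S (t - s) (F (P n s))) (S (t - s) (F (y s))) = norm (S (t - s) (F (P n s - y s)))"
            by (simp add: dist_norm blinfun.bilinear_simps)
          also have "\<dots> \<le> M * norm (F (P n s - y s))" using s by (intro M) auto
          also have "\<dots> \<le> M * (norm F * norm (P n s - y s))"
            using M(1) by (intro mult_left_mono norm_blinfun) auto
          also have "\<dots> = (M * norm F) * norm (P n s - y s)" by simp
          also have "\<dots> \<le> c * norm (P n s - y s)" using c by (intro mult_right_mono) auto
          also have "\<dots> < e" using elim s c by (simp add: dist_norm field_simps)
          finally show "dist (S (t - s) (F (P n s))) (S (t - s) (F (y s))) < e" .
        qed
      qed
    qed
    moreover have "continuous_on {0..t} (\<lambda>s. S (t - s) (F (P n s)))" for n
      unfolding P_def
      by (intro convolution_integrand_continuous continuous_intros continuous_on_subset[OF Yc]) auto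
    ultimately obtain I J where I: "\<And>n. ((\<lambda>s. S (t - s) (F (P n s))) has_integral I n) {0..t}"
      and J: "((\<lambda>s. S (t - s) (F (y s))) has_integral J) {0..t}" and IJ: "I \<longlonglongrightarrow> J"
      using uniform_limit_integral[OF _ _ sequentially_bot] by blast
    have In: "I n = P (Suc n) t - S t h" for n
    proof -
      have "((\<lambda>s. \<Sum>i<n. S (t - s) (F (Y i s))) has_integral (\<Sum>i<n. Y (Suc i) t)) {0..t}"
        unfolding YS by (intro has_integral_sum integrable_integral integrable_continuous_interval Yi) auto
      then have "((\<lambda>s. S (t - s) (F (P n s))) has_integral (\<Sum>i<n. Y (Suc i) t)) {0..t}"
        unfolding P_def by (simp add: blinfun.sum_right)
      then have "I n = (\<Sum>i<n. Y (Suc i) t)" using has_integral_unique[OF I] by blast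
      also have "\<dots> = P (Suc n) t - S t h"
        unfolding P_def sum.lessThan_Suc_shift by (simp add: Y0)
      finally show ?thesis .
    qed
    have "(\<lambda>n. P n t) \<longlonglongrightarrow> y t"
      using tendsto_uniform_limitI[OF unif[of t], of t] t unfolding P_def by simp
    then have "(\<lambda>n. P (Suc n) t - S t h) \<longlonglongrightarrow> y t - S t h"
      by (intro tendsto_intros LIMSEQ_Suc)
    then have "I \<longlonglongrightarrow> y t - S t h" using In by presburger
    then have "J = y t - S t h" using IJ LIMSEQ_unique by blast
    with J show ?thesis by simp
  qed
  then show ?thesis using cont unfolding perturbed_orbit_def by blast
qed

lemma perturbed_orbit_restart:
  assumes "perturbed_orbit F h y" "0 \<le> r"
  shows "perturbed_orbit F (y r) (\<lambda>t. y (r + t))"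
  unfolding perturbed_orbit_def
proof (intro conjI allI impI)
  have "continuous_on {0..} y" using assms unfolding perturbed_orbit_def by blast
  then show "continuous_on {0..} (\<lambda>t. y (r + t))"
    by (rule continuous_on_compose2) (use assms(2) in \<open>auto intro!: continuous_intros\<close>)
  fix t :: real assume "0 \<le> t"
  then show "((\<lambda>s. S (t - s) (F (y (r + s)))) has_integral (y (r + t) - S t (y r))) {0..t}"
    using mild_restart[of "\<lambda>s. F (y s)" y h r t] assms unfolding perturbed_orbit_def by simp
qed

lemma perturbed_orbit_start: "perturbed_orbit F h y \<Longrightarrow> y 0 = h"
proof -
  assume "perturbed_orbit F h y"
  then have "((\<lambda>s. S (0 - s) (F (y s))) has_integral (y 0 - S 0 h)) {0..0}"
    unfolding perturbed_orbit_def by blast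
  from has_integral_unique[OF this has_integral_null_real] show "y 0 = h" by simp
qed

text \<open>Only the deviation from the free orbit is differentiable for arbitrary \<open>h\<close>: neither \<open>y\<close> nor
  \<open>\<lambda>r. S r h\<close> has a derivative at 0 unless \<open>h\<close> lies in the domain of the generator.\<close>

lemma perturbed_orbit_derivative:
  assumes y: "perturbed_orbit F h y"
  shows "((\<lambda>r. (y r - S r h) /\<^sub>R r) \<longlongrightarrow> F h) (at_right 0)"
proof (rule tendstoI)
  fix e :: real assume e: "0 < e"
  have cont: "continuous_on {0..} y" using y unfolding perturbed_orbit_def by blast
  define X where "X = {p :: real \<times> real. 0 \<le> snd p \<and> snd p \<le> fst p}"
  have "continuous_on X (\<lambda>p. S (fst p - snd p) (F (y (snd p))))"
  proof (rule S_jointly_continuous)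
    show "continuous_on X (\<lambda>p. fst p - snd p)" by (intro continuous_intros)
    have "continuous_on X (\<lambda>p. y (snd p))"
      by (rule continuous_on_compose2[OF cont continuous_on_snd[OF continuous_on_id]])
        (auto simp: X_def)
    then show "continuous_on X (\<lambda>p. F (y (snd p)))" by (intro continuous_intros)
  qed (auto simp: X_def)
  moreover have "(0, 0) \<in> X" unfolding X_def by simp
  ultimately obtain d where d: "0 < d" "\<And>p. p \<in> X \<Longrightarrow> dist p (0, 0) < d \<Longrightarrow>
      dist (S (fst p - snd p) (F (y (snd p)))) (S (0 - 0) (F (y 0))) < e / 2"
    unfolding continuous_on_iff using e by (metis fst_conv snd_conv half_gt_zero)
  have "dist ((y r - S r h) /\<^sub>R r) (F h) < e" if r: "0 < r" "r < d / 2" for r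
  proof -
    have hi: "((\<lambda>s. S (r - s) (F (y s))) has_integral (y r - S r h)) {0..r}"
      using y r unfolding perturbed_orbit_def by simp
    then have hd: "((\<lambda>s. S (r - s) (F (y s)) - F h) has_integral (y r - S r h - r *\<^sub>R F h)) {0..r}"
      using has_integral_diff[OF hi has_integral_const_real[of "F h" 0 r]] r by simp
    have "norm (S (r - s) (F (y s)) - F h) \<le> e / 2" if s: "s \<in> {0..r}" for s
    proof -
      have "dist (r, s) (0, 0) \<le> \<bar>r\<bar> + \<bar>s\<bar>"
        by (simp add: dist_Pair_Pair sqrt_sum_squares_le_sum_abs)
      then have "dist (r, s) (0, 0) < d" using s r by simp
      then show ?thesis
        using d(2)[of "(r, s)"] s perturbed_orbit_start[OF y] by (simp add: X_def dist_norm)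
    qed
    then have "norm (y r - S r h - r *\<^sub>R F h) \<le> e / 2 * r"
      using has_integral_bound_real[OF _ finite.emptyI hd, of "e / 2"] e r by simp
    then have 1: "norm (y r - S r h - r *\<^sub>R F h) / r \<le> e / 2" using r by (simp add: field_simps)
    have 2: "(y r - S r h) /\<^sub>R r - F h = (1 / r) *\<^sub>R (y r - S r h - r *\<^sub>R F h)"
      using r by (simp add: scaleR_diff_right inverse_eq_divide)
    have "dist ((y r - S r h) /\<^sub>R r) (F h) = norm (y r - S r h - r *\<^sub>R F h) / r"
      unfolding dist_norm 2 norm_scaleR using r by simp
    with 1 have "dist ((y r - S r h) /\<^sub>R r) (F h) \<le> e / 2" by simp
    then show ?thesis using e by simp
  qed
  then show "\<forall>\<^sub>F r in at_right 0. dist ((y r - S r h) /\<^sub>R r) (F h) < e"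
    unfolding eventually_at_right_field using d(1) by (intro exI[of _ "d / 2"]) auto
qed

end

section \<open>Exponential decay of square integrable flows\<close>

text \<open>Datko's theorem. The bound on \<open>{0..1}\<close> lets the norm at time \<open>t\<close> be estimated by the mean square over
  the preceding unit of time, so orbits are bounded; then \<open>t * (norm (\<Phi> t x))\<^sup>2\<close> is bounded by the
  integral, and the flow halves all norms after some fixed time \<open>\<tau>\<close>.\<close>

lemma exponential_decay_if_square_integrable:
  fixes \<Phi> :: "real \<Rightarrow> 'a::real_normed_vector \<Rightarrow> 'a"
  assumes flow: "\<And>s t x. 0 \<le> s \<Longrightarrow> 0 \<le> t \<Longrightarrow> \<Phi> (s + t) x = \<Phi> s (\<Phi> t x)"
    and cont: "\<And>x. continuous_on {0..} (\<lambda>t. \<Phi> t x)"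
    and loc: "\<And>t x. t \<in> {0..1} \<Longrightarrow> norm (\<Phi> t x) \<le> M * norm x"
    and int: "\<And>t x. 0 \<le> t \<Longrightarrow> integral {0..t} (\<lambda>s. (norm (\<Phi> s x))\<^sup>2) \<le> C * (norm x)\<^sup>2"
  shows "\<exists>L>0. \<exists>d>0. \<forall>t\<ge>0. \<forall>x. norm (\<Phi> t x) \<le> L * exp (- d * t) * norm x"
proof -
  have ck: "(\<lambda>s. k * (norm (\<Phi> s x))\<^sup>2) integrable_on {a..b}" if "0 \<le> a" for k a b x
    using that by (intro integrable_continuous_interval continuous_intros continuous_on_subset[OF cont]) auto
  have ci: "(\<lambda>s. (norm (\<Phi> s x))\<^sup>2) integrable_on {a..b}" if "0 \<le> a" for a b x
    using ck[OF that, of 1] by simp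
  define M' where "M' = \<bar>M\<bar> + 1"
  define C' where "C' = \<bar>C\<bar> + 1"
  have M': "1 \<le> M'" and C': "1 \<le> C'" unfolding M'_def C'_def by auto
  have loc': "norm (\<Phi> t x) \<le> M' * norm x" if "t \<in> {0..1}" for t x
    by (rule order_trans[OF loc[OF that] mult_right_mono]) (simp_all add: M'_def)
  have int': "integral {a..b} (\<lambda>s. (norm (\<Phi> s x))\<^sup>2) \<le> C' * (norm x)\<^sup>2" if "0 \<le> a" "a \<le> b" for a b x
  proof -
    have "integral {a..b} (\<lambda>s. (norm (\<Phi> s x))\<^sup>2) \<le> integral {0..b} (\<lambda>s. (norm (\<Phi> s x))\<^sup>2)"
      using that by (intro integral_subset_le ci) auto
    also have "\<dots> \<le> C * (norm x)\<^sup>2" using that by (intro int) auto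
    also have "\<dots> \<le> C' * (norm x)\<^sup>2" unfolding C'_def by (intro mult_right_mono) auto
    finally show ?thesis .
  qed
  define L where "L = M' * C'"
  have L: "1 \<le> L" unfolding L_def using mult_mono[OF M' C'] M' by simp
  have bounded: "norm (\<Phi> t x) \<le> L * norm x" if t: "0 \<le> t" for t x
  proof (cases "t \<le> 1")
    case True
    have "norm (\<Phi> t x) \<le> M' * norm x" using loc' t True by simp
    also have "\<dots> \<le> L * norm x" unfolding L_def using M' C'
      by (intro mult_right_mono) (auto simp: mult_le_cancel_left1)
    finally show ?thesis .
  next
    case False
    have "(norm (\<Phi> t x))\<^sup>2 = integral {t - 1..t} (\<lambda>s. (norm (\<Phi> t x))\<^sup>2)" by simp
    also have "\<dots> \<le> integral {t - 1..t} (\<lambda>s. M'\<^sup>2 * (norm (\<Phi> s x))\<^sup>2)"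
    proof (rule integral_le)
      show "(\<lambda>s. M'\<^sup>2 * (norm (\<Phi> s x))\<^sup>2) integrable_on {t - 1..t}"
        using False by (intro ck) auto
      fix s assume s: "s \<in> {t - 1..t}"
      have "\<Phi> t x = \<Phi> (t - s) (\<Phi> s x)" using flow[of "t - s" s x] s False by simp
      then have "norm (\<Phi> t x) \<le> M' * norm (\<Phi> s x)" using loc'[of "t - s" "\<Phi> s x"] s by simp
      then have "(norm (\<Phi> t x))\<^sup>2 \<le> (M' * norm (\<Phi> s x))\<^sup>2" by (intro power_mono) auto
      then show "(norm (\<Phi> t x))\<^sup>2 \<le> M'\<^sup>2 * (norm (\<Phi> s x))\<^sup>2" by (simp add: power_mult_distrib)
    qed auto
    also have "\<dots> = M'\<^sup>2 * integral {t - 1..t} (\<lambda>s. (norm (\<Phi> s x))\<^sup>2)" by simp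
    also have "\<dots> \<le> M'\<^sup>2 * (C' * (norm x)\<^sup>2)" using False by (intro mult_left_mono int') auto
    also have "\<dots> \<le> M'\<^sup>2 * (C'\<^sup>2 * (norm x)\<^sup>2)"
      using C' by (intro mult_left_mono mult_right_mono) (auto simp: power2_eq_square)
    finally have "(norm (\<Phi> t x))\<^sup>2 \<le> (L * norm x)\<^sup>2" unfolding L_def by (simp add: power_mult_distrib)
    then show ?thesis by (rule power2_le_imp_le) (use L in simp)
  qed
  define \<tau> where "\<tau> = 4 * L\<^sup>2 * C'"
  have \<tau>: "0 < \<tau>" unfolding \<tau>_def using L C' by simp
  have half: "norm (\<Phi> \<tau> x) \<le> norm x / 2" for x
  proof -
    have "\<tau> * (norm (\<Phi> \<tau> x))\<^sup>2 = integral {0..\<tau>} (\<lambda>s. (norm (\<Phi> \<tau> x))\<^sup>2)" using \<tau> by simp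
    also have "\<dots> \<le> integral {0..\<tau>} (\<lambda>s. L\<^sup>2 * (norm (\<Phi> s x))\<^sup>2)"
    proof (rule integral_le)
      show "(\<lambda>s. L\<^sup>2 * (norm (\<Phi> s x))\<^sup>2) integrable_on {0..\<tau>}"
        by (intro ck) auto
      fix s assume s: "s \<in> {0..\<tau>}"
      have "\<Phi> \<tau> x = \<Phi> (\<tau> - s) (\<Phi> s x)" using flow[of "\<tau> - s" s x] s by simp
      then have "norm (\<Phi> \<tau> x) \<le> L * norm (\<Phi> s x)" using bounded[of "\<tau> - s" "\<Phi> s x"] s by simp
      then have "(norm (\<Phi> \<tau> x))\<^sup>2 \<le> (L * norm (\<Phi> s x))\<^sup>2" by (intro power_mono) auto
      then show "(norm (\<Phi> \<tau> x))\<^sup>2 \<le> L\<^sup>2 * (norm (\<Phi> s x))\<^sup>2" by (simp add: power_mult_distrib)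
    qed auto
    also have "\<dots> = L\<^sup>2 * integral {0..\<tau>} (\<lambda>s. (norm (\<Phi> s x))\<^sup>2)" by simp
    also have "\<dots> \<le> L\<^sup>2 * (C' * (norm x)\<^sup>2)" using \<tau> by (intro mult_left_mono int') auto
    finally have "4 * (L\<^sup>2 * C') * (norm (\<Phi> \<tau> x))\<^sup>2 \<le> (L\<^sup>2 * C') * (norm x)\<^sup>2"
      unfolding \<tau>_def by simp
    then have "(L\<^sup>2 * C') * (4 * (norm (\<Phi> \<tau> x))\<^sup>2) \<le> (L\<^sup>2 * C') * (norm x)\<^sup>2" by (simp add: mult_ac)
    moreover have "0 < L\<^sup>2 * C'" using L C' by simp
    ultimately have "4 * (norm (\<Phi> \<tau> x))\<^sup>2 \<le> (norm x)\<^sup>2" by (simp only: mult_le_cancel_left_pos)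
    then have "(norm (\<Phi> \<tau> x))\<^sup>2 \<le> (norm x / 2)\<^sup>2" by (simp add: power_divide)
    then show ?thesis by (rule power2_le_imp_le) simp
  qed
  have iter: "norm (\<Phi> (r + real n * \<tau>) x) \<le> L * (1/2) ^ n * norm x" if r: "0 \<le> r" for n r x
  proof (induction n arbitrary: x)
    case 0
    show ?case using bounded[OF r] by simp
  next
    case (Suc n)
    have "\<Phi> (r + real (Suc n) * \<tau>) x = \<Phi> (r + real n * \<tau>) (\<Phi> \<tau> x)"
      using flow[of "r + real n * \<tau>" \<tau> x] r \<tau> by (simp add: algebra_simps)
    then have "norm (\<Phi> (r + real (Suc n) * \<tau>) x) \<le> L * (1/2) ^ n * norm (\<Phi> \<tau> x)"
      using Suc.IH by simp
    also have "\<dots> \<le> L * (1/2) ^ n * (norm x / 2)" using L by (intro mult_left_mono half) auto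
    finally show ?case by simp
  qed
  define d where "d = ln 2 / \<tau>"
  have d: "0 < d" unfolding d_def using \<tau> by simp
  have "norm (\<Phi> t x) \<le> 2 * L * exp (- d * t) * norm x" if t: "0 \<le> t" for t x
  proof -
    define n where "n = nat \<lfloor>t / \<tau>\<rfloor>"
    have n: "real n \<le> t / \<tau>" "t / \<tau> < real n + 1"
      unfolding n_def using t \<tau> by (auto simp: of_nat_nat)
    then have r: "0 \<le> t - real n * \<tau>" using \<tau> by (simp add: field_simps)
    have "norm (\<Phi> t x) \<le> L * (1/2) ^ n * norm x"
      using iter[OF r, of n x] by simp
    also have "\<dots> \<le> L * (2 * exp (- d * t)) * norm x"
    proof (intro mult_right_mono mult_left_mono)
      have "exp (- ln 2) = (1/2 :: real)" by (simp add: exp_minus)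
      then have "(1/2 :: real) ^ n = exp (- ln 2 * real n)"
        using exp_of_nat_mult[of n "- ln 2 :: real"] by (simp only: mult.commute)
      also have "\<dots> \<le> exp (ln 2 - d * t)"
      proof -
        have "ln 2 * (t / \<tau>) \<le> ln 2 * (real n + 1)" using n(2) by (intro mult_left_mono) auto
        then show ?thesis unfolding d_def by (simp add: algebra_simps)
      qed
      also have "\<dots> = 2 * exp (- d * t)" by (simp add: exp_diff exp_minus field_simps)
      finally show "(1/2 :: real) ^ n \<le> 2 * exp (- d * t)" .
    qed (use L in auto)
    finally show ?thesis by simp
  qed
  moreover have "0 < 2 * L" using L by simp
  ultimately show ?thesis using d by blast
qed

section \<open>Strongly measurable functions\<close>

text \<open>Bochner measurability on the half line. As the limit of simple functions it is stable under linear
  combinations in nonseparable spaces too, where Borel measurability is not.\<close>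

definition strongly_measurable :: "(real \<Rightarrow> 'x::real_normed_vector) \<Rightarrow> bool" where
  "strongly_measurable u \<longleftrightarrow> (\<exists>s. (\<forall>n::nat. simple_function lebesgue (s n)) \<and>
     (AE t in lebesgue. 0 \<le> t \<longrightarrow> (\<lambda>n. s n t) \<longlonglongrightarrow> u t))"

lemma strongly_measurable_lin_comb:
  assumes "strongly_measurable u" "strongly_measurable v"
  shows "strongly_measurable (\<lambda>t. a *\<^sub>R u t + b *\<^sub>R v t)"
proof -
  obtain p q where s: "\<And>n. simple_function lebesgue (p n)" "\<And>n. simple_function lebesgue (q n)"
    and p: "AE t in lebesgue. 0 \<le> t \<longrightarrow> (\<lambda>n. p n t) \<longlonglongrightarrow> u t"
    and q: "AE t in lebesgue. 0 \<le> t \<longrightarrow> (\<lambda>n. q n t) \<longlonglongrightarrow> v t"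
    using assms unfolding strongly_measurable_def by blast
  have "simple_function lebesgue (\<lambda>t. a *\<^sub>R p n t + b *\<^sub>R q n t)" for n
    using simple_function_compose2[OF s, of "\<lambda>x y. a *\<^sub>R x + b *\<^sub>R y"] .
  moreover have "AE t in lebesgue. 0 \<le> t \<longrightarrow>
      (\<lambda>n. a *\<^sub>R p n t + b *\<^sub>R q n t) \<longlonglongrightarrow> a *\<^sub>R u t + b *\<^sub>R v t"
    using p q by eventually_elim (auto intro!: tendsto_intros)
  ultimately show ?thesis
    unfolding strongly_measurable_def by (intro exI[of _ "\<lambda>n t. a *\<^sub>R p n t + b *\<^sub>R q n t"]) auto
qed

lemma AE_lebesgue_translation:
  fixes P :: "real \<Rightarrow> bool"
  assumes "AE t in lebesgue. P t"
  shows "AE t in lebesgue. P (r + t)"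
proof -
  obtain N where N: "{t. \<not> P t} \<subseteq> N" "N \<in> null_sets lebesgue"
    using assms by (auto simp: eventually_ae_filter)
  have "(+) (- r) ` N \<in> null_sets lebesgue"
    using negligible_translation[of N "- r"] N(2) by (simp add: negligible_iff_null_sets)
  moreover have "{t \<in> space lebesgue. \<not> P (r + t)} \<subseteq> (+) (- r) ` N"
  proof
    fix t assume "t \<in> {t \<in> space lebesgue. \<not> P (r + t)}"
    then have "r + t \<in> N" using N(1) by auto
    then show "t \<in> (+) (- r) ` N" by (intro image_eqI[of _ _ "r + t"]) auto
  qed
  ultimately show ?thesis by (intro AE_I') auto
qed

lemma strongly_measurable_translation:
  assumes "strongly_measurable u" "0 \<le> r"
  shows "strongly_measurable (\<lambda>t. u (r + t))"
proof -
  obtain p where s: "\<And>n. simple_function lebesgue (p n)"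
    and p: "AE t in lebesgue. 0 \<le> t \<longrightarrow> (\<lambda>n. p n t) \<longlonglongrightarrow> u t"
    using assms unfolding strongly_measurable_def by blast
  have "(\<lambda>t :: real. r + t) \<in> lebesgue \<rightarrow>\<^sub>M lebesgue"
    using lebesgue_affine_measurable[of "\<lambda>_. 1 :: real" r] by simp
  then have "simple_function lebesgue (\<lambda>t. p n (r + t))" for n
    using simple_function_comp s by blast
  moreover have "AE t in lebesgue. 0 \<le> t \<longrightarrow> (\<lambda>n. p n (r + t)) \<longlonglongrightarrow> u (r + t)"
    using AE_lebesgue_translation[OF p, of r] by eventually_elim (use assms(2) in auto)
  ultimately show ?thesis
    unfolding strongly_measurable_def by (intro exI[of _ "\<lambda>n t. p n (r + t)"]) auto
qed

lemma strongly_measurable_square_integrable: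
  assumes u: "strongly_measurable u" and g: "g integrable_on {0..T}"
    and le: "AE t in lebesgue. t \<in> {0..T} \<longrightarrow> (norm (u t))\<^sup>2 \<le> g t"
  shows "(\<lambda>t. (norm (u t))\<^sup>2) integrable_on {0..T}"
proof -
  obtain p where s: "\<And>n. simple_function lebesgue (p n)"
    and p: "AE t in lebesgue. 0 \<le> t \<longrightarrow> (\<lambda>n. p n t) \<longlonglongrightarrow> u t"
    using u unfolding strongly_measurable_def by blast
  have "AE t in lebesgue. (0 \<le> t \<longrightarrow> (\<lambda>n. p n t) \<longlonglongrightarrow> u t) \<and>
      (t \<in> {0..T} \<longrightarrow> (norm (u t))\<^sup>2 \<le> g t)"
    using p le by eventually_elim blast
  then obtain N where N: "{t. \<not> ((0 \<le> t \<longrightarrow> (\<lambda>n. p n t) \<longlonglongrightarrow> u t) \<and>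
      (t \<in> {0..T} \<longrightarrow> (norm (u t))\<^sup>2 \<le> g t))} \<subseteq> N" "N \<in> null_sets lebesgue"
    unfolding eventually_ae_filter by auto
  have Nm: "N \<in> sets lebesgue" using N(2) by auto
  define E where "E = {0..T} - N"
  have E: "E \<in> sets lebesgue" unfolding E_def using Nm by auto
  have "(\<lambda>t. if t \<in> E then (norm (u t))\<^sup>2 else 0) \<in> borel_measurable lebesgue"
  proof (rule borel_measurable_LIMSEQ_real)
    fix n
    have "(\<lambda>t. (norm (p n t))\<^sup>2) \<in> borel_measurable lebesgue"
      using simple_function_compose1[OF s[of n], of "\<lambda>x. (norm x)\<^sup>2"]
      by (rule borel_measurable_simple_function)
    then show "(\<lambda>t. if t \<in> E then (norm (p n t))\<^sup>2 else 0) \<in> borel_measurable lebesgue"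
      using E by (intro measurable_If_set) auto
  next
    fix t :: real
    show "(\<lambda>n. if t \<in> E then (norm (p n t))\<^sup>2 else 0) \<longlonglongrightarrow> (if t \<in> E then (norm (u t))\<^sup>2 else 0)"
    proof (cases "t \<in> E")
      case True
      then have "(\<lambda>n. p n t) \<longlonglongrightarrow> u t" using N(1) unfolding E_def by auto
      then show ?thesis using True by (auto intro!: tendsto_intros)
    qed simp
  qed
  then have 1: "(\<lambda>t. if t \<in> E then (norm (u t))\<^sup>2 else 0) \<in> borel_measurable (lebesgue_on {0..T})"
    by (intro measurable_restrict_space1)
  have 2: "(\<lambda>t. if t \<in> N then 0 else g t) integrable_on {0..T}"
    using g N(2) by (rule_tac integrable_spike[of g]) (auto simp: negligible_iff_null_sets)
  have 3: "norm (if t \<in> E then (norm (u t))\<^sup>2 else 0) \<le> (if t \<in> N then 0 else g t)"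
    if "t \<in> {0..T}" for t
    using that N(1) unfolding E_def by auto
  have "(\<lambda>t. if t \<in> E then (norm (u t))\<^sup>2 else 0) integrable_on {0..T}"
    by (rule measurable_bounded_by_integrable_imp_integrable[OF 1 2 3]) auto
  then show ?thesis
    using N(2) by (rule_tac integrable_spike[of "\<lambda>t. if t \<in> E then (norm (u t))\<^sup>2 else 0"])
      (auto simp: negligible_iff_null_sets E_def)
qed

text \<open>The approximating simple functions sample \<open>y\<close> on the grid of mesh \<open>1 / (n + 1)\<close> in \<open>{0..n + 1}\<close>.\<close>

lemma strongly_measurable_continuous:
  fixes y :: "real \<Rightarrow> 'x::real_normed_vector"
  assumes y: "continuous_on {0..} y"
  shows "strongly_measurable y"
proof -
  define k :: "nat \<Rightarrow> real \<Rightarrow> int" where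
    "k n t = max (- 1) (min ((int n + 1)\<^sup>2) \<lfloor>(real n + 1) * t\<rfloor>)" for n t
  define p where "p n t = y (of_int (k n t) / (real n + 1))" for n t
  have "simple_function lebesgue (k n)" for n
  proof -
    have "(\<lambda>t. \<lfloor>(real n + 1) * t\<rfloor>) \<in> lebesgue \<rightarrow>\<^sub>M count_space UNIV"
      by (rule measurable_compose[OF _ measurable_real_floor]) (auto intro!: measurable_completion)
    then have "k n \<in> lebesgue \<rightarrow>\<^sub>M count_space UNIV"
      unfolding k_def by (rule measurable_compose) simp
    moreover have "k n ` space lebesgue \<subseteq> {-1..max (- 1) ((int n + 1)\<^sup>2)}" unfolding k_def by auto
    ultimately show ?thesis
      unfolding simple_function_eq_measurable using finite_subset by blast
  qed
  then have "simple_function lebesgue (p n)" for n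
    unfolding p_def by (rule simple_function_compose1)
  moreover have "(\<lambda>n. p n t) \<longlonglongrightarrow> y t" if t: "0 \<le> t" for t
  proof -
    have kn: "k n t = \<lfloor>(real n + 1) * t\<rfloor>" if "t \<le> real n" for n
    proof -
      have "(real n + 1) * t \<le> (real n + 1) * (real n + 1)" using that by (intro mult_left_mono) auto
      also have "\<dots> = of_int ((int n + 1)\<^sup>2)" by (simp add: power2_eq_square)
      finally have "\<lfloor>(real n + 1) * t\<rfloor> \<le> (int n + 1)\<^sup>2" by linarith
      moreover have "0 \<le> \<lfloor>(real n + 1) * t\<rfloor>" using t by simp
      moreover from this have "- 1 \<le> \<lfloor>(real n + 1) * t\<rfloor>" by linarith
      ultimately show ?thesis unfolding k_def by (simp only: min_absorb2 max_absorb2)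
    qed
    have "(\<lambda>n. of_int \<lfloor>(real n + 1) * t\<rfloor> / (real n + 1)) \<longlonglongrightarrow> t"
    proof (rule tendsto_sandwich[of "\<lambda>n. t - 1 / (real n + 1)" _ _ "\<lambda>_. t"])
      have low: "t - 1 / (real n + 1) \<le> of_int \<lfloor>(real n + 1) * t\<rfloor> / (real n + 1)" for n
      proof -
        have "((real n + 1) * t - 1) / (real n + 1) \<le> of_int \<lfloor>(real n + 1) * t\<rfloor> / (real n + 1)"
          by (intro divide_right_mono) linarith+
        then show ?thesis by (simp add: diff_divide_distrib)
      qed
      have up: "of_int \<lfloor>(real n + 1) * t\<rfloor> / (real n + 1) \<le> t" for n
      proof -
        have "of_int \<lfloor>(real n + 1) * t\<rfloor> / (real n + 1) \<le> ((real n + 1) * t) / (real n + 1)"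
          by (intro divide_right_mono) linarith+
        then show ?thesis by simp
      qed
      show "\<forall>\<^sub>F n in sequentially. t - 1 / (real n + 1) \<le> of_int \<lfloor>(real n + 1) * t\<rfloor> / (real n + 1)"
        "\<forall>\<^sub>F n in sequentially. of_int \<lfloor>(real n + 1) * t\<rfloor> / (real n + 1) \<le> t"
        using low up by simp_all
      have "(\<lambda>n. t - 1 / real (Suc n)) \<longlonglongrightarrow> t - 0"
        by (intro tendsto_intros LIMSEQ_Suc[OF lim_1_over_n])
      then show "(\<lambda>n. t - 1 / (real n + 1)) \<longlonglongrightarrow> t" by (simp add: add.commute)
    qed simp
    moreover have "(\<lambda>n. of_int \<lfloor>(real n + 1) * t\<rfloor> / (real n + 1)) \<in> UNIV \<rightarrow> {0..}" using t by auto
    ultimately have "(\<lambda>n. y (of_int \<lfloor>(real n + 1) * t\<rfloor> / (real n + 1))) \<longlonglongrightarrow> y t"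
      using y t unfolding continuous_on_sequentially o_def by (auto simp: Pi_iff)
    moreover obtain N :: nat where N: "t \<le> real N" using real_arch_simple by blast
    have "\<forall>\<^sub>F n in sequentially. y (of_int \<lfloor>(real n + 1) * t\<rfloor> / (real n + 1)) = p n t"
      unfolding eventually_sequentially using N by (intro exI[of _ N]) (auto simp: p_def kn)
    ultimately show ?thesis by (rule Lim_transform_eventually)
  qed
  ultimately show ?thesis
    unfolding strongly_measurable_def by (intro exI[of _ "p"]) auto
qed

lemma strongly_measurable_apply:
  fixes K :: "real \<Rightarrow> 'x::real_normed_vector \<Rightarrow>\<^sub>L 'y::real_normed_vector"
  assumes "strongly_measurable K" "strongly_measurable y"
  shows "strongly_measurable (\<lambda>t. K t (y t))"
proof -
  obtain p q where s: "\<And>n. simple_function lebesgue (p n)" "\<And>n. simple_function lebesgue (q n)"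
    and p: "AE t in lebesgue. 0 \<le> t \<longrightarrow> (\<lambda>n. p n t) \<longlonglongrightarrow> K t"
    and q: "AE t in lebesgue. 0 \<le> t \<longrightarrow> (\<lambda>n. q n t) \<longlonglongrightarrow> y t"
    using assms unfolding strongly_measurable_def by blast
  have "simple_function lebesgue (\<lambda>t. p n t (q n t))" for n
    using simple_function_compose2[OF s, of blinfun_apply] .
  moreover have "AE t in lebesgue. 0 \<le> t \<longrightarrow> (\<lambda>n. p n t (q n t)) \<longlonglongrightarrow> K t (y t)"
    using p q by eventually_elim (auto intro!: tendsto_intros)
  ultimately show ?thesis
    unfolding strongly_measurable_def by (intro exI[of _ "\<lambda>n t. p n t (q n t)"]) auto
qed

section \<open>Strong continuity of the adjoint semigroup\<close>

locale hilbert_C0_sg = C0_sg S for S :: "real \<Rightarrow> 'h::{real_inner, banach} \<Rightarrow>\<^sub>L 'h"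
begin

text \<open>The adjoint semigroup is strongly continuous at 0, stated for functionals. The elements \<open>p\<close> with
  norm-continuous dual orbit form a closed subspace \<open>Z\<close>, and \<open>Z\<close> contains the representers of the
  averages of the dual orbit of \<open>f\<close> over short times. These averages converge weakly to \<open>f\<close>, so the
  component of \<open>f\<close> orthogonal to \<open>Z\<close> vanishes. On a general Banach space dual orbits can fail to be
  continuous in norm.\<close>

lemma dual_orbit_continuous:
  assumes f: "bounded_linear (f :: 'h \<Rightarrow> real)" and e: "0 < e"
  shows "\<exists>d>0. \<forall>t\<in>{0..<d}. \<forall>x. \<bar>f (S t x) - f x\<bar> \<le> e * norm x"
proof -
  define Z where "Z = {p. \<forall>e>0. \<exists>d>0. \<forall>t\<in>{0..<d}. \<forall>x. \<bar>p \<bullet> S t x - p \<bullet> x\<bar> \<le> e * norm x}"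
  obtain M where M: "1 \<le> M" "\<And>t x. t \<in> {0..2} \<Longrightarrow> norm (S t x) \<le> M * norm x"
    using S_locally_bounded[of 2] by blast
  have subZ: "subspace Z"
  proof (rule subspaceI)
    show "0 \<in> Z" unfolding Z_def by (auto intro!: exI[of _ 1])
  next
    fix p q assume pq: "p \<in> Z" "q \<in> Z"
    show "p + q \<in> Z" unfolding Z_def
    proof (intro CollectI allI impI)
      fix e :: real assume "0 < e"
      then have e2: "0 < e / 2" by simp
      obtain d1 where d1: "d1 > 0" "\<And>t x. t \<in> {0..<d1} \<Longrightarrow> \<bar>p \<bullet> S t x - p \<bullet> x\<bar> \<le> e / 2 * norm x"
        using pq(1) e2 unfolding Z_def by blast
      obtain d2 where d2: "d2 > 0" "\<And>t x. t \<in> {0..<d2} \<Longrightarrow> \<bar>q \<bullet> S t x - q \<bullet> x\<bar> \<le> e / 2 * norm x"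
        using pq(2) e2 unfolding Z_def by blast
      have "\<bar>(p + q) \<bullet> S t x - (p + q) \<bullet> x\<bar> \<le> e * norm x" if t: "t \<in> {0..<min d1 d2}" for t x
      proof -
        have "\<bar>p \<bullet> S t x - p \<bullet> x\<bar> \<le> e / 2 * norm x" "\<bar>q \<bullet> S t x - q \<bullet> x\<bar> \<le> e / 2 * norm x"
          using d1(2)[of t x] d2(2)[of t x] t by auto
        moreover have "(p + q) \<bullet> S t x - (p + q) \<bullet> x = (p \<bullet> S t x - p \<bullet> x) + (q \<bullet> S t x - q \<bullet> x)"
          by (simp add: inner_add_left)
        ultimately show ?thesis by linarith
      qed
      then show "\<exists>d>0. \<forall>t\<in>{0..<d}. \<forall>x. \<bar>(p + q) \<bullet> S t x - (p + q) \<bullet> x\<bar> \<le> e * norm x"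
        using d1(1) d2(1) by (intro exI[of _ "min d1 d2"]) auto
    qed
  next
    fix c p assume p: "p \<in> Z"
    show "c *\<^sub>R p \<in> Z" unfolding Z_def
    proof (intro CollectI allI impI)
      fix e :: real assume e: "0 < e"
      then have "0 < e / (\<bar>c\<bar> + 1)" by simp
      then obtain d where d: "d > 0" "\<And>t x. t \<in> {0..<d} \<Longrightarrow> \<bar>p \<bullet> S t x - p \<bullet> x\<bar> \<le> e / (\<bar>c\<bar> + 1) * norm x"
        using p unfolding Z_def by blast
      have "\<bar>(c *\<^sub>R p) \<bullet> S t x - (c *\<^sub>R p) \<bullet> x\<bar> \<le> e * norm x" if t: "t \<in> {0..<d}" for t x
      proof -
        have "\<bar>(c *\<^sub>R p) \<bullet> S t x - (c *\<^sub>R p) \<bullet> x\<bar> = \<bar>c\<bar> * \<bar>p \<bullet> S t x - p \<bullet> x\<bar>"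
          by (simp add: abs_mult[symmetric] right_diff_distrib)
        also have "\<dots> \<le> (\<bar>c\<bar> + 1) * (e / (\<bar>c\<bar> + 1) * norm x)"
          using d(2)[OF t, of x] by (intro mult_mono) auto
        also have "\<dots> = e * norm x" by (simp add: add_nonneg_eq_0_iff)
        finally show ?thesis .
      qed
      then show "\<exists>d>0. \<forall>t\<in>{0..<d}. \<forall>x. \<bar>(c *\<^sub>R p) \<bullet> S t x - (c *\<^sub>R p) \<bullet> x\<bar> \<le> e * norm x"
        using d(1) by blast
    qed
  qed
  have closedZ: "closed Z"
  proof -
    have "p \<in> Z" if p: "p \<in> closure Z" for p
      unfolding Z_def
    proof (intro CollectI allI impI)
      fix e :: real assume e: "0 < e"
      then have "0 < e / (2 * (M + 1))" using M(1) by simp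
      then obtain q where q: "q \<in> Z" "dist q p < e / (2 * (M + 1))"
        using p unfolding closure_approachable by blast
      have "0 < e / 2" using e by simp
      then obtain d where d: "d > 0" "\<And>t x. t \<in> {0..<d} \<Longrightarrow> \<bar>q \<bullet> S t x - q \<bullet> x\<bar> \<le> e / 2 * norm x"
        using q(1) unfolding Z_def by blast
      have "\<bar>p \<bullet> S t x - p \<bullet> x\<bar> \<le> e * norm x" if t: "t \<in> {0..<min d 1}" for t x
      proof -
        have "norm (S t x - x) \<le> (M + 1) * norm x"
          using M(2)[of t x] t norm_triangle_ineq4[of "S t x" x] by (simp add: algebra_simps)
        then have "norm (p - q) * norm (S t x - x) \<le> e / (2 * (M + 1)) * ((M + 1) * norm x)"
          using q(2) e M(1) by (intro mult_mono) (auto simp: dist_norm norm_minus_commute)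
        moreover have hM: "e / (2 * (M + 1)) * ((M + 1) * norm x) = e / 2 * norm x"
          using M(1) by (simp add: field_simps)
        ultimately have "\<bar>(p - q) \<bullet> (S t x - x)\<bar> \<le> e / 2 * norm x"
          using Cauchy_Schwarz_ineq2[of "p - q" "S t x - x"] hM by linarith
        moreover have "p \<bullet> S t x - p \<bullet> x = (p - q) \<bullet> (S t x - x) + (q \<bullet> S t x - q \<bullet> x)"
          by (simp add: inner_diff)
        moreover have "\<bar>q \<bullet> S t x - q \<bullet> x\<bar> \<le> e / 2 * norm x" using d(2)[of t x] t by simp
        ultimately show ?thesis by linarith
      qed
      then show "\<exists>d>0. \<forall>t\<in>{0..<d}. \<forall>x. \<bar>p \<bullet> S t x - p \<bullet> x\<bar> \<le> e * norm x"
        using d(1) by (intro exI[of _ "min d 1"]) auto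
    qed
    then have "closure Z \<subseteq> Z" by (rule subsetI)
    then show ?thesis by (simp only: closure_subset_eq)
  qed
  interpret f: bounded_linear f by (rule f)
  obtain c where c: "c > 0" "\<And>x. norm (f x) \<le> norm x * c" using f.pos_bounded by blast
  have fc: "continuous_on {a..b} (\<lambda>s. f (S s x))" if "0 \<le> a" for a b x
    using that by (intro f.continuous_on continuous_on_subset[OF S_orbit_continuous]) auto
  have fi: "(\<lambda>s. f (S s x)) integrable_on {a..b}" if "0 \<le> a" for a b x
    by (intro integrable_continuous_interval fc that)
  have fb: "\<bar>f (S s x)\<bar> \<le> c * M * norm x" if "s \<in> {0..2}" for s x
  proof -
    have "\<bar>f (S s x)\<bar> \<le> norm (S s x) * c" using c(2) by simp
    also have "\<dots> \<le> (M * norm x) * c" using M(2)[OF that] c(1) by (intro mult_right_mono) auto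
    finally show ?thesis by (simp add: mult_ac)
  qed
  have ib: "\<bar>integral {a..b} (\<lambda>s. f (S s x))\<bar> \<le> c * M * norm x * (b - a)"
    if "0 \<le> a" "a \<le> b" "b \<le> 2" for a b x
    using integral_bound[OF that(2) fc[OF that(1)], of x "c * M * norm x"] fb that by auto
  \<comment> \<open>time averages of the dual orbit of \<open>f\<close> are represented by elements of \<open>Z\<close>\<close>
  have avg: "\<exists>q\<in>Z. \<forall>x. integral {0..\<delta>} (\<lambda>s. f (S s x)) = q \<bullet> x" if \<delta>: "0 < \<delta>" "\<delta> \<le> 1" for \<delta>
  proof -
    define g where "g x = integral {0..\<delta>} (\<lambda>s. f (S s x))" for x
    have "bounded_linear g"
    proof (rule bounded_linear_intro)
      show "g (x + y) = g x + g y" for x y unfolding g_def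
        by (simp add: blinfun.bilinear_simps f.add Henstock_Kurzweil_Integration.integral_add fi)
      show "g (r *\<^sub>R x) = r *\<^sub>R g x" for r x unfolding g_def
        by (simp add: blinfun.bilinear_simps f.scaleR)
      show "norm (g x) \<le> norm x * (c * M * \<delta>)" for x
        using ib[of 0 \<delta> x] \<delta> unfolding g_def by (simp add: mult_ac)
    qed
    from Riesz_on_closed_subspace[OF this subspace_UNIV closed_UNIV]
    obtain q where q: "\<And>x. g x = q \<bullet> x" by auto
    have "q \<in> Z" unfolding Z_def
    proof (intro CollectI allI impI)
      fix e :: real assume e: "0 < e"
      have cM: "0 < 2 * (c * M)" using c(1) M(1) by simp
      define d where "d = min 1 (e / (2 * (c * M)))"
      have d: "0 < d" "d \<le> 1" "d \<le> e / (2 * (c * M))" unfolding d_def using e cM by auto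
      have "\<bar>q \<bullet> S t x - q \<bullet> x\<bar> \<le> e * norm x" if t: "t \<in> {0..<d}" for t x
      proof -
        let ?F = "\<lambda>s. f (S s x)"
        have t2: "0 \<le> t" "t \<le> 1" using t d by auto
        have "q \<bullet> S t x = integral {0..\<delta>} (\<lambda>s. ?F (t + s))"
          unfolding q[symmetric] g_def using t2
          by (intro integral_cong) (simp add: S_add[symmetric] add.commute)
        also have "\<dots> = integral {t..\<delta> + t} ?F"
          using integral_shift_Icc_real[of 0 \<delta> ?F t] by (simp add: o_def)
        finally have 1: "q \<bullet> S t x = integral {t..\<delta> + t} ?F" .
        have 2: "integral {0..t} ?F + integral {t..\<delta> + t} ?F = integral {0..\<delta> + t} ?F"
          using t2 \<delta> by (intro Henstock_Kurzweil_Integration.integral_combine fi) auto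
        have 3: "integral {0..\<delta>} ?F + integral {\<delta>..\<delta> + t} ?F = integral {0..\<delta> + t} ?F"
          using t2 \<delta> by (intro Henstock_Kurzweil_Integration.integral_combine fi) auto
        have "q \<bullet> S t x - q \<bullet> x = integral {\<delta>..\<delta> + t} ?F - integral {0..t} ?F"
          using 1 2 3 q[of x] unfolding g_def by linarith
        moreover have "\<bar>integral {0..t} ?F\<bar> \<le> c * M * norm x * t"
          using ib[of 0 t x] t2 by simp
        moreover have "\<bar>integral {\<delta>..\<delta> + t} ?F\<bar> \<le> c * M * norm x * t"
          using ib[of \<delta> "\<delta> + t" x] t2 \<delta> by simp
        ultimately have "\<bar>q \<bullet> S t x - q \<bullet> x\<bar> \<le> c * M * norm x * t + c * M * norm x * t"
          by linarith
        also have "\<dots> = 2 * (c * M) * t * norm x" by simp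
        also have "\<dots> \<le> e * norm x"
        proof (rule mult_right_mono)
          have "2 * (c * M) * t \<le> 2 * (c * M) * (e / (2 * (c * M)))"
            using t d cM by (intro mult_left_mono) auto
          moreover have "M \<noteq> 0" using M(1) by simp
          ultimately show "2 * (c * M) * t \<le> e" using c(1) by simp
        qed simp
        finally show ?thesis .
      qed
      then show "\<exists>d>0. \<forall>t\<in>{0..<d}. \<forall>x. \<bar>q \<bullet> S t x - q \<bullet> x\<bar> \<le> e * norm x"
        using d(1) by blast
    qed
    then show ?thesis using q unfolding g_def by blast
  qed
  obtain p where p: "\<And>x. f x = p \<bullet> x"
    using Riesz_on_closed_subspace[OF f subspace_UNIV closed_UNIV] by auto
  obtain z where z: "z \<in> Z" "\<And>x. x \<in> Z \<Longrightarrow> f x = z \<bullet> x"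
    using Riesz_on_closed_subspace[OF f subZ closedZ] by blast
  define r where "r = p - z"
  have orth: "r \<bullet> x = 0" if "x \<in> Z" for x
    using z(2)[OF that] p[of x] unfolding r_def by (simp add: inner_diff_left)
  have "f r = 0"
  proof (rule ccontr)
    assume "f r \<noteq> 0"
    then have pos: "0 < \<bar>f r\<bar> / (2 * c)" using c(1) by simp
    obtain d where d: "d > 0" "\<And>s. s \<in> {0..<d} \<Longrightarrow> norm (S s r - r) < \<bar>f r\<bar> / (2 * c)"
      using S_continuous_at_zero[OF pos, of r] by blast
    define \<delta> where "\<delta> = min 1 (d / 2)"
    have \<delta>: "0 < \<delta>" "\<delta> \<le> 1" "\<delta> < d" unfolding \<delta>_def using d(1) by auto
    obtain q where q: "q \<in> Z" "integral {0..\<delta>} (\<lambda>s. f (S s r)) = q \<bullet> r" using avg[OF \<delta>(1,2)] by blast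
    have "integral {0..\<delta>} (\<lambda>s. f (S s r)) = 0" using q orth by (simp add: inner_commute)
    then have "integral {0..\<delta>} (\<lambda>s. f (S s r) - f r) = - \<delta> * f r"
      using \<delta> by (subst Henstock_Kurzweil_Integration.integral_diff) (auto intro!: fi)
    moreover have "norm (integral {0..\<delta>} (\<lambda>s. f (S s r) - f r)) \<le> \<bar>f r\<bar> / 2 * (\<delta> - 0)"
    proof (rule integral_bound)
      show "continuous_on {0..\<delta>} (\<lambda>s. f (S s r) - f r)" by (intro continuous_intros fc) simp
      fix s assume s: "s \<in> {0..\<delta>}"
      have "norm (f (S s r) - f r) \<le> norm (S s r - r) * c" using c(2)[of "S s r - r"] by (simp add: f.diff)
      also have "\<dots> \<le> \<bar>f r\<bar> / (2 * c) * c"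
        using d(2)[of s] s \<delta> c(1) by (intro mult_right_mono) auto
      finally show "norm (f (S s r) - f r) \<le> \<bar>f r\<bar> / 2" using c(1) by simp
    qed (use \<delta> in auto)
    ultimately have "\<delta> * \<bar>f r\<bar> \<le> \<bar>f r\<bar> / 2 * \<delta>" using \<delta> by (simp add: abs_mult)
    then show False using \<delta>(1) \<open>f r \<noteq> 0\<close> by simp
  qed
  then have "r \<bullet> r = 0" using p[of r] orth[OF z(1)] unfolding r_def by (simp add: inner_diff inner_commute)
  then have "p \<in> Z" using z(1) unfolding r_def by simp
  then show ?thesis unfolding Z_def using e p by simp
qed

end

section \<open>Trajectories and their cost\<close>

locale control_system = hilbert_C0_sg S
  for S :: "real \<Rightarrow> 'h::{real_inner, banach} \<Rightarrow>\<^sub>L 'h" +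
  fixes B :: "'h \<Rightarrow>\<^sub>L 'h" and D :: "'u::{real_inner, banach} \<Rightarrow>\<^sub>L 'h"
begin

text \<open>Pairs of a state and a control function. Measurability and local square integrability of the
  control are included so that costs are defined and trajectories are closed under linear
  combinations.\<close>

definition trajectory :: "'h \<Rightarrow> (real \<Rightarrow> 'h) \<Rightarrow> (real \<Rightarrow> 'u) \<Rightarrow> bool" where
  "trajectory h y u \<longleftrightarrow> continuous_on {0..} y \<and>
     (\<forall>t\<ge>0. ((\<lambda>s. S (t - s) (D (u s) - B (y s))) has_integral (y t - S t h)) {0..t}) \<and>
     strongly_measurable u \<and> (\<forall>t\<ge>0. (\<lambda>s. (norm (u s))\<^sup>2) integrable_on {0..t})"

definition running_cost :: "(real \<Rightarrow> 'h) \<Rightarrow> (real \<Rightarrow> 'u) \<Rightarrow> real \<Rightarrow> real" where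
  "running_cost y u t = integral {0..t} (\<lambda>s. (norm (y s))\<^sup>2 + (norm (u s))\<^sup>2)"

text \<open>A cost over the infinite horizon is rendered by an upper bound \<open>J\<close> of the running costs, which avoids
  improper integrals.\<close>

definition admissible_cost :: "'h \<Rightarrow> real \<Rightarrow> bool" where
  "admissible_cost h J \<longleftrightarrow> (\<exists>y u. trajectory h y u \<and> (\<forall>t\<ge>0. running_cost y u t \<le> J))"

definition optimal_cost :: "'h \<Rightarrow> real" where
  "optimal_cost h = Inf {J. admissible_cost h J}"

lemma running_cost_integrable:
  assumes "trajectory h y u" "0 \<le> a"
  shows "(\<lambda>s. (norm (y s))\<^sup>2 + (norm (u s))\<^sup>2) integrable_on {a..b}"
proof (cases "a \<le> b")
  case True
  have "(\<lambda>s. (norm (y s))\<^sup>2) integrable_on {0..b}"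
    using assms(1) unfolding trajectory_def
    by (auto intro!: integrable_continuous_interval continuous_intros elim: continuous_on_subset)
  moreover have "(\<lambda>s. (norm (u s))\<^sup>2) integrable_on {0..b}"
    using assms True unfolding trajectory_def by simp
  ultimately have "(\<lambda>s. (norm (y s))\<^sup>2 + (norm (u s))\<^sup>2) integrable_on {0..b}" by (rule integrable_add)
  then show ?thesis by (rule integrable_subinterval_real) (use assms(2) in auto)
qed auto

lemma running_cost_combine:
  assumes "trajectory h y u" "0 \<le> r" "r \<le> t"
  shows "running_cost y u t = running_cost y u r + integral {r..t} (\<lambda>s. (norm (y s))\<^sup>2 + (norm (u s))\<^sup>2)"
  unfolding running_cost_def
  by (rule Henstock_Kurzweil_Integration.integral_combine[OF assms(2,3), symmetric])
    (rule running_cost_integrable[OF assms(1)], simp)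

lemma running_cost_mono:
  assumes "trajectory h y u" "0 \<le> r" "r \<le> t"
  shows "running_cost y u r \<le> running_cost y u t"
  unfolding running_cost_combine[OF assms]
  using Henstock_Kurzweil_Integration.integral_nonneg[OF running_cost_integrable[OF assms(1,2)]] by simp

lemma running_cost_zero [simp]: "running_cost y u 0 = 0"
  unfolding running_cost_def by simp

lemma trajectory_restart:
  assumes tr: "trajectory h y u" and r: "0 \<le> r"
  shows "trajectory (y r) (\<lambda>t. y (r + t)) (\<lambda>t. u (r + t))"
  unfolding trajectory_def
proof (intro conjI allI impI)
  have "continuous_on {0..} y" using tr unfolding trajectory_def by blast
  then show "continuous_on {0..} (\<lambda>t. y (r + t))"
    by (rule continuous_on_compose2) (use r in \<open>auto intro!: continuous_intros\<close>)
  show "strongly_measurable (\<lambda>t. u (r + t))"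
    using tr r unfolding trajectory_def by (intro strongly_measurable_translation) auto
  fix t :: real assume t: "0 \<le> t"
  show "((\<lambda>s. S (t - s) (D (u (r + s)) - B (y (r + s)))) has_integral
      (y (r + t) - S t (y r))) {0..t}"
    using mild_restart[of "\<lambda>s. D (u s) - B (y s)" y h r t] tr r t unfolding trajectory_def by simp
  have "(\<lambda>s. (norm (u s))\<^sup>2) integrable_on {0..r + t}"
    using tr r t unfolding trajectory_def by simp
  then have "(\<lambda>s. (norm (u s))\<^sup>2) integrable_on {r..r + t}"
    by (rule integrable_subinterval_real) (use r in auto)
  from integrable_shift_real_ivl[OF this, of r]
  show "(\<lambda>s. (norm (u (r + s)))\<^sup>2) integrable_on {0..t}" by (simp add: add.commute)
qed

lemma running_cost_restart:
  assumes tr: "trajectory h y u" and r: "0 \<le> r" and t: "0 \<le> t"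
  shows "running_cost (\<lambda>t. y (r + t)) (\<lambda>t. u (r + t)) t = running_cost y u (r + t) - running_cost y u r"
  using running_cost_combine[OF tr r, of "r + t"] t
    integral_shift_Icc_real[of 0 t "\<lambda>s. (norm (y s))\<^sup>2 + (norm (u s))\<^sup>2" r]
  unfolding running_cost_def by (simp add: o_def add.commute)

lemma trajectory_lin_comb:
  assumes 1: "trajectory h y u" and 2: "trajectory k z v"
  shows "trajectory (a *\<^sub>R h + b *\<^sub>R k) (\<lambda>t. a *\<^sub>R y t + b *\<^sub>R z t) (\<lambda>t. a *\<^sub>R u t + b *\<^sub>R v t)"
  unfolding trajectory_def
proof (intro conjI allI impI)
  show "continuous_on {0..} (\<lambda>t. a *\<^sub>R y t + b *\<^sub>R z t)"
    using 1 2 unfolding trajectory_def by (auto intro!: continuous_intros)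
  show m: "strongly_measurable (\<lambda>t. a *\<^sub>R u t + b *\<^sub>R v t)"
    using 1 2 unfolding trajectory_def by (intro strongly_measurable_lin_comb) auto
  fix t :: real assume t: "0 \<le> t"
  have "((\<lambda>s. a *\<^sub>R S (t - s) (D (u s) - B (y s)) + b *\<^sub>R S (t - s) (D (v s) - B (z s))) has_integral
      (a *\<^sub>R (y t - S t h) + b *\<^sub>R (z t - S t k))) {0..t}"
    using 1 2 t unfolding trajectory_def by (intro has_integral_add has_integral_cmul) auto
  then show "((\<lambda>s. S (t - s) (D (a *\<^sub>R u s + b *\<^sub>R v s) - B (a *\<^sub>R y s + b *\<^sub>R z s))) has_integral
      (a *\<^sub>R y t + b *\<^sub>R z t - S t (a *\<^sub>R h + b *\<^sub>R k))) {0..t}"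
    by (simp add: blinfun.bilinear_simps algebra_simps)
  show "(\<lambda>s. (norm (a *\<^sub>R u s + b *\<^sub>R v s))\<^sup>2) integrable_on {0..t}"
  proof (rule strongly_measurable_square_integrable[OF m])
    show "(\<lambda>s. 2 * a\<^sup>2 * (norm (u s))\<^sup>2 + 2 * b\<^sup>2 * (norm (v s))\<^sup>2) integrable_on {0..t}"
      using 1 2 t unfolding trajectory_def
      by (intro integrable_add integrable_on_mult_right) auto
    have "(norm (p + q))\<^sup>2 \<le> 2 * (norm p)\<^sup>2 + 2 * (norm q)\<^sup>2" for p q :: 'u
      using parallelogram_law[of p q] zero_le_power2[of "norm (p - q)"] by linarith
    from this[of "a *\<^sub>R u _" "b *\<^sub>R v _"]
    show "AE s in lebesgue. s \<in> {0..t} \<longrightarrow>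
        (norm (a *\<^sub>R u s + b *\<^sub>R v s))\<^sup>2 \<le> 2 * a\<^sup>2 * (norm (u s))\<^sup>2 + 2 * b\<^sup>2 * (norm (v s))\<^sup>2"
      by (simp add: power_mult_distrib mult.assoc)
  qed
qed

lemma admissible_cost_nonneg: "admissible_cost h J \<Longrightarrow> 0 \<le> J"
  unfolding admissible_cost_def by (metis order_refl running_cost_zero)

lemma optimal_cost_le: "admissible_cost h J \<Longrightarrow> optimal_cost h \<le> J"
  unfolding optimal_cost_def
  by (rule cInf_lower) (auto intro!: bdd_belowI[of _ 0] admissible_cost_nonneg)

lemma admissible_cost_scale:
  assumes "admissible_cost h J"
  shows "admissible_cost (c *\<^sub>R h) (c\<^sup>2 * J)"
proof -
  obtain y u where tr: "trajectory h y u" and J: "\<And>t. 0 \<le> t \<Longrightarrow> running_cost y u t \<le> J"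
    using assms unfolding admissible_cost_def by blast
  have "running_cost (\<lambda>t. c *\<^sub>R y t) (\<lambda>t. c *\<^sub>R u t) t = c\<^sup>2 * running_cost y u t" for t
    unfolding running_cost_def by (simp add: power_mult_distrib distrib_left[symmetric])
  then have "running_cost (\<lambda>t. c *\<^sub>R y t) (\<lambda>t. c *\<^sub>R u t) t \<le> c\<^sup>2 * J" if "0 \<le> t" for t
    using J[OF that] by (simp add: mult_left_mono)
  moreover have "trajectory (c *\<^sub>R h) (\<lambda>t. c *\<^sub>R y t) (\<lambda>t. c *\<^sub>R u t)"
    using trajectory_lin_comb[OF tr tr, of c 0] by simp
  ultimately show ?thesis unfolding admissible_cost_def by blast
qed

text \<open>The sum and the difference of two trajectories are trajectories, and their running costs add up by
  the parallelogram law. The total \<open>2 * J + 2 * R\<close> is divided between them at the supremum \<open>P\<close> of the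
  running cost of the sum.\<close>

lemma admissible_cost_parallelogram:
  assumes "admissible_cost h J" "admissible_cost k R"
  shows "optimal_cost (h + k) + optimal_cost (h - k) \<le> 2 * J + 2 * R"
proof -
  obtain y u where 1: "trajectory h y u" and J: "\<And>t. 0 \<le> t \<Longrightarrow> running_cost y u t \<le> J"
    using assms(1) unfolding admissible_cost_def by blast
  obtain z v where 2: "trajectory k z v" and R: "\<And>t. 0 \<le> t \<Longrightarrow> running_cost z v t \<le> R"
    using assms(2) unfolding admissible_cost_def by blast
  have tp: "trajectory (h + k) (\<lambda>t. y t + z t) (\<lambda>t. u t + v t)"
    using trajectory_lin_comb[OF 1 2, of 1 1] by simp
  have tm: "trajectory (h - k) (\<lambda>t. y t - z t) (\<lambda>t. u t - v t)"
    using trajectory_lin_comb[OF 1 2, of 1 "- 1"] by simp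
  define cp where "cp = running_cost (\<lambda>t. y t + z t) (\<lambda>t. u t + v t)"
  define cm where "cm = running_cost (\<lambda>t. y t - z t) (\<lambda>t. u t - v t)"
  have sum: "cp t + cm t \<le> 2 * J + 2 * R" if t: "0 \<le> t" for t
  proof -
    have "cp t + cm t = integral {0..t} (\<lambda>s. ((norm (y s + z s))\<^sup>2 + (norm (u s + v s))\<^sup>2) +
        ((norm (y s - z s))\<^sup>2 + (norm (u s - v s))\<^sup>2))"
      unfolding cp_def cm_def running_cost_def
      by (intro Henstock_Kurzweil_Integration.integral_add[symmetric]
          running_cost_integrable[OF tp] running_cost_integrable[OF tm]) auto
    also have "\<dots> = integral {0..t} (\<lambda>s. 2 * ((norm (y s))\<^sup>2 + (norm (u s))\<^sup>2) + 2 * ((norm (z s))\<^sup>2 + (norm (v s))\<^sup>2))"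
    proof (rule integral_cong)
      fix s
      show "((norm (y s + z s))\<^sup>2 + (norm (u s + v s))\<^sup>2) + ((norm (y s - z s))\<^sup>2 + (norm (u s - v s))\<^sup>2)
          = 2 * ((norm (y s))\<^sup>2 + (norm (u s))\<^sup>2) + 2 * ((norm (z s))\<^sup>2 + (norm (v s))\<^sup>2)"
        using parallelogram_law[of "y s" "z s"] parallelogram_law[of "u s" "v s"] by simp
    qed
    also have "\<dots> = 2 * running_cost y u t + 2 * running_cost z v t"
      unfolding running_cost_def
      by (intro integral_unique has_integral_add has_integral_mult_right integrable_integral
          running_cost_integrable[OF 1] running_cost_integrable[OF 2]) auto
    also have "\<dots> \<le> 2 * J + 2 * R" using J[OF t] R[OF t] by simp
    finally show ?thesis .
  qed
  \<comment> \<open>both running costs increase, so their suprema add up to at most the same bound\<close>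
  have cross: "cp s + cm t \<le> 2 * J + 2 * R" if "0 \<le> s" "0 \<le> t" for s t
  proof -
    have "cp s \<le> cp (max s t)" unfolding cp_def by (rule running_cost_mono[OF tp]) (use that in auto)
    moreover have "cm t \<le> cm (max s t)" unfolding cm_def by (rule running_cost_mono[OF tm]) (use that in auto)
    moreover have "cp (max s t) + cm (max s t) \<le> 2 * J + 2 * R" using sum that by simp
    ultimately show ?thesis by linarith
  qed
  define P where "P = Sup (cp ` {0..})"
  have bdd: "bdd_above (cp ` {0..})"
    using cross[of _ 0] unfolding cm_def by (auto intro!: bdd_aboveI[of _ "2 * J + 2 * R"])
  have "cp t \<le> P" if "0 \<le> t" for t
    unfolding P_def using that by (intro cSup_upper bdd) auto
  then have "optimal_cost (h + k) \<le> P"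
    using tp unfolding cp_def by (intro optimal_cost_le) (auto simp: admissible_cost_def)
  moreover have "cm t \<le> 2 * J + 2 * R - P" if t: "0 \<le> t" for t
  proof -
    have "P \<le> 2 * J + 2 * R - cm t" unfolding P_def
      using cross[OF _ t] by (intro cSup_least) (auto simp: algebra_simps)
    then show ?thesis by simp
  qed
  then have "optimal_cost (h - k) \<le> 2 * J + 2 * R - P"
    using tm unfolding cm_def by (intro optimal_cost_le) (auto simp: admissible_cost_def)
  ultimately show ?thesis by simp
qed

end

section \<open>The optimal cost as a quadratic form\<close>

text \<open>The hypothesis of open-loop stabilizability at finite quadratic cost.\<close>

locale finite_cost_system = control_system S B D
  for S :: "real \<Rightarrow> 'h::{real_inner, banach} \<Rightarrow>\<^sub>L 'h" and B :: "'h \<Rightarrow>\<^sub>L 'h"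
    and D :: "'u::{real_inner, banach} \<Rightarrow>\<^sub>L 'h" +
  fixes C :: real
  assumes finite_cost: "admissible_cost h (C * (norm h)\<^sup>2)"
begin

lemma optimal_cost_nonneg: "0 \<le> optimal_cost h"
  unfolding optimal_cost_def using finite_cost[of h]
  by (intro cInf_greatest) (auto intro: admissible_cost_nonneg)

lemma near_optimal:
  assumes "0 < e"
  obtains J where "admissible_cost h J" "J < optimal_cost h + e"
proof -
  have "Inf {J. admissible_cost h J} < optimal_cost h + e"
    unfolding optimal_cost_def using assms by simp
  then have "\<exists>J\<in>{J. admissible_cost h J}. J < optimal_cost h + e"
    using finite_cost[of h] by (subst (asm) cInf_less_iff) (auto intro!: bdd_belowI[of _ 0] admissible_cost_nonneg)
  then show ?thesis using that by blast
qed

lemma optimal_cost_scale_le: "optimal_cost (c *\<^sub>R h) \<le> c\<^sup>2 * optimal_cost h"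
proof (cases "c = 0")
  case False
  show ?thesis
  proof (rule field_le_epsilon)
    fix e :: real assume "0 < e"
    then have "0 < e / c\<^sup>2" using False by simp
    then obtain J where J: "admissible_cost h J" "J < optimal_cost h + e / c\<^sup>2" by (rule near_optimal)
    have "optimal_cost (c *\<^sub>R h) \<le> c\<^sup>2 * J"
      by (intro optimal_cost_le admissible_cost_scale J)
    also have "\<dots> \<le> c\<^sup>2 * (optimal_cost h + e / c\<^sup>2)" using J(2) by (intro mult_left_mono) auto
    also have "\<dots> = c\<^sup>2 * optimal_cost h + e" using False by (simp add: algebra_simps)
    finally show "optimal_cost (c *\<^sub>R h) \<le> c\<^sup>2 * optimal_cost h + e" .
  qed
qed (use optimal_cost_le[OF finite_cost[of 0]] in simp)

lemma optimal_cost_parallelogram_le: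
  "optimal_cost (h + k) + optimal_cost (h - k) \<le> 2 * optimal_cost h + 2 * optimal_cost k"
proof (rule field_le_epsilon)
  fix e :: real assume "0 < e"
  then have e: "0 < e / 4" by simp
  obtain J where J: "admissible_cost h J" "J < optimal_cost h + e / 4" using e by (rule near_optimal)
  obtain R where R: "admissible_cost k R" "R < optimal_cost k + e / 4" using e by (rule near_optimal)
  show "optimal_cost (h + k) + optimal_cost (h - k) \<le> 2 * optimal_cost h + 2 * optimal_cost k + e"
    using admissible_cost_parallelogram[OF J(1) R(1)] J(2) R(2) by linarith
qed

text \<open>The inequality already proved, applied to \<open>h + k\<close> and \<open>h - k\<close>, is the converse one.\<close>

lemma optimal_cost_parallelogram:
  "optimal_cost (h + k) + optimal_cost (h - k) = 2 * optimal_cost h + 2 * optimal_cost k"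
proof (rule antisym[OF optimal_cost_parallelogram_le])
  have "optimal_cost x \<le> optimal_cost (2 *\<^sub>R x) / 4" for x
    using optimal_cost_scale_le[of "1/2" "2 *\<^sub>R x"] by (simp add: power_divide)
  from this[of h] this[of k] optimal_cost_parallelogram_le[of "h + k" "h - k"]
  show "2 * optimal_cost h + 2 * optimal_cost k \<le> optimal_cost (h + k) + optimal_cost (h - k)"
    by (simp add: scaleR_2)
qed

lemma optimal_cost_quadratic:
  "\<exists>b. bounded_bilinear b \<and> (\<forall>x y. b x y = b y x) \<and> (\<forall>x. b x x = optimal_cost x)"
  by (rule Jordan_von_Neumann[OF optimal_cost_nonneg optimal_cost_le[OF finite_cost]
        optimal_cost_parallelogram])

text \<open>One half of Bellman's principle: the tail of a nearly optimal trajectory costs at least the optimal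
  cost from where it starts.\<close>

lemma dynamic_programming:
  assumes r: "0 \<le> r" and e: "0 < e"
  obtains y u where "trajectory h y u" "running_cost y u r + optimal_cost (y r) \<le> optimal_cost h + e"
    "\<And>t. 0 \<le> t \<Longrightarrow> running_cost y u t \<le> optimal_cost h + e"
proof -
  obtain J where J: "admissible_cost h J" "J < optimal_cost h + e" using e by (rule near_optimal)
  obtain y u where tr: "trajectory h y u" and le: "\<And>t. 0 \<le> t \<Longrightarrow> running_cost y u t \<le> J"
    using J(1) unfolding admissible_cost_def by blast
  have "running_cost (\<lambda>t. y (r + t)) (\<lambda>t. u (r + t)) t \<le> J - running_cost y u r" if "0 \<le> t" for t
    unfolding running_cost_restart[OF tr r that] using le[of "r + t"] r that by simp
  then have "optimal_cost (y r) \<le> J - running_cost y u r"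
    using trajectory_restart[OF tr r] by (intro optimal_cost_le) (auto simp: admissible_cost_def)
  moreover have "running_cost y u t \<le> optimal_cost h + e" if "0 \<le> t" for t
    using le[OF that] J(2) by simp
  ultimately show ?thesis using that[OF tr] J(2) by simp
qed

end

section \<open>The Riccati inequality\<close>

text \<open>Completing the square. With \<open>p\<close> and \<open>q\<close> standing for the contributions of \<open>D v\<close> and \<open>B x\<close> to the change of
  the optimal cost, and \<open>g \<bullet> v\<close>, \<open>c0\<close> for their values at time 0, minimizing
  \<open>(norm v)\<^sup>2 + 2 * (g \<bullet> v)\<close> over \<open>v\<close> gives \<open>- (norm g)\<^sup>2\<close>; the factor of \<open>\<eta>\<close> collects all errors.\<close>

lemma running_cost_pointwise_bound:
  fixes g v :: "'u::real_inner" and x h :: "'h::real_inner" and \<eta> d \<beta> c0 k0 q :: real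
  assumes "0 \<le> \<eta>" "\<eta> \<le> 1" "0 \<le> d" "0 \<le> \<beta>" "0 \<le> k0"
    and x: "norm (x - h) \<le> \<eta>"
    and Dv: "g \<bullet> v - \<eta> * (d * norm v) \<le> p"
    and Bx: "q \<le> c0 + k0 * (\<beta> * norm (x - h)) + \<eta> * (\<beta> * norm x)"
  shows "(norm h)\<^sup>2 - 2 * c0 - (norm g)\<^sup>2
      - \<eta> * (2 * norm g * d + d\<^sup>2 + 2 * norm h + 2 * (\<beta> * (norm h + 1)) + 2 * (k0 * \<beta>))
    \<le> (norm x)\<^sup>2 + (norm v)\<^sup>2 + 2 * (p - q)"
proof -
  have h: "(norm h)\<^sup>2 - \<eta> * (2 * norm h) \<le> (norm x)\<^sup>2"
  proof -
    have "norm h \<le> norm x + \<eta>" using x norm_triangle_sub[of h x] by (simp add: norm_minus_commute)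
    then have "norm h * norm h \<le> norm h * (norm x + \<eta>)" by (intro mult_left_mono) auto
    moreover have "0 \<le> (norm h - norm x)\<^sup>2" by simp
    ultimately show ?thesis by (simp add: power2_eq_square algebra_simps)
  qed
  have "- (norm g + \<eta> * d)\<^sup>2 \<le> (norm v)\<^sup>2 + 2 * p"
  proof -
    have "- (norm g * norm v) \<le> g \<bullet> v" using Cauchy_Schwarz_ineq2[of g v] by linarith
    then have "- ((norm g + \<eta> * d) * norm v) \<le> p" using Dv by (simp add: algebra_simps)
    moreover have "0 \<le> (norm v - (norm g + \<eta> * d))\<^sup>2" by simp
    ultimately show ?thesis by (simp add: power2_eq_square algebra_simps)
  qed
  moreover have "(norm g + \<eta> * d)\<^sup>2 \<le> (norm g)\<^sup>2 + \<eta> * (2 * norm g * d + d\<^sup>2)"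
  proof -
    have "\<eta> * \<eta> * d\<^sup>2 \<le> \<eta> * 1 * d\<^sup>2"
      using assms by (intro mult_right_mono mult_left_mono) auto
    then show ?thesis by (simp add: power2_eq_square algebra_simps)
  qed
  moreover have "q \<le> c0 + \<eta> * (k0 * \<beta> + \<beta> * (norm h + 1))"
  proof -
    have "k0 * (\<beta> * norm (x - h)) \<le> k0 * (\<beta> * \<eta>)"
      using assms by (intro mult_left_mono) auto
    moreover have "norm x \<le> norm h + 1" using x assms(2) norm_triangle_sub[of x h] by simp
    then have "\<eta> * (\<beta> * norm x) \<le> \<eta> * (\<beta> * (norm h + 1))"
      using assms by (intro mult_left_mono) auto
    ultimately show ?thesis using Bx by (simp add: algebra_simps)
  qed
  ultimately show ?thesis using h by (simp add: algebra_simps)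
qed

context finite_cost_system
begin

text \<open>A bound on the cost bounds the control in the mean square only, but on short time intervals this
  already forces the state to follow the free orbit, uniformly in all such trajectories.\<close>

lemma trajectory_near_free_orbit:
  assumes J: "0 < J" and \<eta>: "0 < \<eta>"
  shows "\<exists>d>0. d \<le> 1 \<and> (\<forall>h y u. trajectory h y u \<longrightarrow> (\<forall>t\<ge>0. running_cost y u t \<le> J) \<longrightarrow>
    (\<forall>s\<in>{0..d}. norm (y s - S s h) \<le> \<eta>))"
proof -
  obtain M where M: "1 \<le> M" "\<And>t x. t \<in> {0..1} \<Longrightarrow> norm (S t x) \<le> M * norm x"
    using S_locally_bounded[of 1] by blast
  define c where "c = M * (norm D + norm B) + 1"
  have c: "0 < c" unfolding c_def using M(1) by (intro add_nonneg_pos) auto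
  \<comment> \<open>\<open>a \<le> \<kappa> + a\<^sup>2 / \<kappa>\<close> trades the linear bound on the integrand for the cost: \<open>\<kappa>\<close> is so large that the
    quadratic part contributes \<open>\<eta> / 2\<close>, and then \<open>d\<close> so small that the constant part does\<close>
  define \<kappa> where "\<kappa> = 2 * c * J / \<eta>"
  have \<kappa>: "0 < \<kappa>" unfolding \<kappa>_def using c J \<eta> by simp
  define d where "d = min 1 (\<eta> / (4 * c * \<kappa>))"
  have d: "0 < d" "d \<le> 1" "d \<le> \<eta> / (4 * c * \<kappa>)" unfolding d_def using \<eta> c \<kappa> by auto
  have "norm (y s - S s h) \<le> \<eta>"
    if tr: "trajectory h y u" and le: "\<forall>t\<ge>0. running_cost y u t \<le> J" and s: "s \<in> {0..d}" for h y u s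
  proof -
    have hi: "((\<lambda>r. S (s - r) (D (u r) - B (y r))) has_integral (y s - S s h)) {0..s}"
      using tr s unfolding trajectory_def by simp
    let ?q = "\<lambda>r. (norm (y r))\<^sup>2 + (norm (u r))\<^sup>2"
    have gi: "((\<lambda>r. c * (2 * \<kappa>) + c / \<kappa> * ?q r) has_integral
        (c * (2 * \<kappa>) * s + c / \<kappa> * running_cost y u s)) {0..s}"
    proof (intro has_integral_add has_integral_mult_right)
      show "((\<lambda>r. c * (2 * \<kappa>)) has_integral c * (2 * \<kappa>) * s) {0..s}"
        using has_integral_const_real[of "c * (2 * \<kappa>)" 0 s] s by (simp add: mult_ac)
      show "(?q has_integral running_cost y u s) {0..s}"
        unfolding running_cost_def by (intro integrable_integral running_cost_integrable[OF tr]) simp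
    qed
    have "norm (y s - S s h) \<le> integral {0..s} (\<lambda>r. c * (2 * \<kappa>) + c / \<kappa> * ?q r)"
      unfolding integral_unique[OF hi, symmetric]
    proof (rule integral_norm_bound_integral)
      show "(\<lambda>r. S (s - r) (D (u r) - B (y r))) integrable_on {0..s}" using hi by blast
      show "(\<lambda>r. c * (2 * \<kappa>) + c / \<kappa> * ?q r) integrable_on {0..s}" using gi by blast
      fix r assume r: "r \<in> {0..s}"
      have split: "a \<le> \<kappa> + a\<^sup>2 / \<kappa>" if "0 \<le> a" for a
      proof (cases "a \<le> \<kappa>")
        case False
        then have "\<kappa> * a \<le> a * a" using that by (intro mult_right_mono) auto
        then have "a \<le> a\<^sup>2 / \<kappa>" using \<kappa> by (simp add: field_simps power2_eq_square)
        then show ?thesis using \<kappa> by simp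
      qed (use \<kappa> in \<open>simp add: add_increasing2\<close>)
      have "norm (S (s - r) (D (u r) - B (y r))) \<le> M * norm (D (u r) - B (y r))"
        using r s d(2) by (intro M) auto
      also have "\<dots> \<le> M * (norm (D (u r)) + norm (B (y r)))"
        using M(1) by (intro mult_left_mono norm_triangle_ineq4) auto
      also have "\<dots> \<le> M * (norm D * norm (u r) + norm B * norm (y r))"
        using M(1) by (intro mult_left_mono add_mono norm_blinfun) auto
      also have "\<dots> \<le> M * ((norm D + norm B) * (norm (u r) + norm (y r)))"
        using M(1) by (intro mult_left_mono) (auto simp: algebra_simps)
      also have "\<dots> = (M * (norm D + norm B)) * (norm (u r) + norm (y r))" by simp
      also have "\<dots> \<le> c * (norm (u r) + norm (y r))"
        unfolding c_def by (intro mult_right_mono) auto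
      also have "\<dots> \<le> c * ((\<kappa> + (norm (u r))\<^sup>2 / \<kappa>) + (\<kappa> + (norm (y r))\<^sup>2 / \<kappa>))"
        using c by (intro mult_left_mono add_mono split) auto
      also have "\<dots> = c * (2 * \<kappa>) + c / \<kappa> * ?q r"
        using \<kappa> by (simp add: field_simps)
      finally show "norm (S (s - r) (D (u r) - B (y r))) \<le> c * (2 * \<kappa>) + c / \<kappa> * ?q r" .
    qed
    also have "\<dots> = c * (2 * \<kappa>) * s + c / \<kappa> * running_cost y u s" using gi by (rule integral_unique)
    also have "\<dots> \<le> c * (2 * \<kappa>) * (\<eta> / (4 * c * \<kappa>)) + c / \<kappa> * J"
      using s d(3) le c \<kappa> by (intro add_mono mult_left_mono) auto
    also have "\<dots> = \<eta>" using c \<kappa> J \<eta> unfolding \<kappa>_def by (simp add: field_simps)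
    finally show ?thesis .
  qed
  then show ?thesis using d(1,2) by blast
qed

text \<open>The Riccati inequality in integrated form. A nearly optimal trajectory from \<open>h\<close> is compared with the
  free orbit over a short time \<open>r\<close>: the optimal cost is expanded at \<open>S r h\<close>, the quadratic remainder is
  nonnegative, and the linear term together with the running cost is estimated pointwise. Expanding
  at \<open>S r h\<close> rather than at \<open>h\<close> avoids differentiating the free orbit, so that \<open>h\<close> can be arbitrary.\<close>

lemma optimal_cost_lower_expansion:
  assumes bil: "bounded_bilinear b" and sym: "\<And>x y. b x y = b y x"
    and diag: "\<And>x. b x x = optimal_cost x"
    and g: "\<And>v. b h (D v) = g \<bullet> v" and e: "0 < e"
  shows "\<forall>\<^sub>F r in at_right 0. optimal_cost (S r h) +
    r * ((norm h)\<^sup>2 - 2 * b h (B h) - (norm g)\<^sup>2 - e) \<le> optimal_cost h"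
proof -
  interpret b: bounded_bilinear b by (rule bil)
  obtain N where N: "0 < N" "\<And>x y. norm (b x y) \<le> norm x * norm y * N" using b.pos_bounded by blast
  obtain M where M: "1 \<le> M" "\<And>t x. t \<in> {0..1} \<Longrightarrow> norm (S t x) \<le> M * norm x"
    using S_locally_bounded[of 1] by blast
  define k where "k = 2 * norm g * norm D + (norm D)\<^sup>2 + 2 * norm h + 2 * (norm B * (norm h + 1)) +
    2 * ((norm h * N) * norm B)"
  have k: "0 \<le> k" unfolding k_def using N(1) by (intro add_nonneg_nonneg mult_nonneg_nonneg) auto
  define \<eta> where "\<eta> = min 1 (e / (2 * (k + 1)))"
  have \<eta>: "0 < \<eta>" "\<eta> \<le> 1" unfolding \<eta>_def using e k by auto
  have \<eta>k: "\<eta> * k \<le> e / 2"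
  proof -
    have "\<eta> * (k + 1) \<le> e / (2 * (k + 1)) * (k + 1)"
      unfolding \<eta>_def using k by (intro mult_right_mono) auto
    also have "\<dots> = e / 2" using k by (simp add: field_simps)
    finally show ?thesis using \<eta>(1) by (simp add: algebra_simps)
  qed
  have J: "0 < optimal_cost h + 1" using optimal_cost_nonneg[of h] by simp
  have "0 < \<eta> / 2" using \<eta>(1) by simp
  from trajectory_near_free_orbit[OF J this] obtain d1 where d1: "0 < d1" "d1 \<le> 1"
    and near: "\<And>y u s. trajectory h y u \<Longrightarrow> (\<forall>t\<ge>0. running_cost y u t \<le> optimal_cost h + 1) \<Longrightarrow>
      s \<in> {0..d1} \<Longrightarrow> norm (y s - S s h) \<le> \<eta> / 2" by blast
  have "0 < \<eta> / (2 * M * N)" using \<eta>(1) M(1) N(1) by simp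
  from S_continuous_at_zero[OF this, of h] obtain d2 where d2: "0 < d2"
    "\<And>s. s \<in> {0..<d2} \<Longrightarrow> norm (S s h - h) < \<eta> / (2 * M * N)" by blast
  from S_continuous_at_zero[OF \<open>0 < \<eta> / 2\<close>, of h] obtain d3 where d3: "0 < d3"
    "\<And>s. s \<in> {0..<d3} \<Longrightarrow> norm (S s h - h) < \<eta> / 2" by blast
  from dual_orbit_continuous[OF b.bounded_linear_right \<open>0 < \<eta> / 2\<close>, of h] obtain d4 where d4: "0 < d4"
    "\<And>s x. s \<in> {0..<d4} \<Longrightarrow> \<bar>b h (S s x) - b h x\<bar> \<le> \<eta> / 2 * norm x" by blast
  define d where "d = min (min d1 d2) (min d3 d4)"
  have d: "0 < d" "d \<le> d1" "d \<le> d2" "d \<le> d3" "d \<le> d4" unfolding d_def using d1 d2 d3 d4 by auto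
  have "optimal_cost (S r h) + r * ((norm h)\<^sup>2 - 2 * b h (B h) - (norm g)\<^sup>2 - e) \<le> optimal_cost h"
    if r: "0 < r" "r < d" for r
  proof -
    define e' where "e' = min 1 (e / 2 * r)"
    have e': "0 < e'" "e' \<le> 1" "e' \<le> e / 2 * r" unfolding e'_def using e r by auto
    obtain y u where tr: "trajectory h y u"
      and dp: "running_cost y u r + optimal_cost (y r) \<le> optimal_cost h + e'"
      and rc: "\<And>t. 0 \<le> t \<Longrightarrow> running_cost y u t \<le> optimal_cost h + e'"
      using dynamic_programming[of r e' h] r e'(1) by (metis less_imp_le)
    have rc1: "\<forall>t\<ge>0. running_cost y u t \<le> optimal_cost h + 1" using rc e'(2) by force
    have ys: "norm (y s - h) \<le> \<eta>" if s: "s \<in> {0..r}" for s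
    proof -
      have "norm (y s - S s h) \<le> \<eta> / 2" using s r d by (intro near[OF tr rc1]) auto
      moreover have "norm (S s h - h) < \<eta> / 2" using s r d by (intro d3) auto
      ultimately show ?thesis using norm_triangle_ineq[of "y s - S s h" "S s h - h"] by simp
    qed
    \<comment> \<open>the functional \<open>b (S r h)\<close> transported back along the semigroup stays close to \<open>b h\<close>\<close>
    have dual: "\<bar>b (S r h) (S (r - s) w) - b h w\<bar> \<le> \<eta> * norm w" if s: "s \<in> {0..r}" for s w
    proof -
      have "\<bar>b (S r h - h) (S (r - s) w)\<bar> \<le> norm (S r h - h) * norm (S (r - s) w) * N"
        using N(2)[of "S r h - h"] by simp
      also have "\<dots> \<le> \<eta> / (2 * M * N) * (M * norm w) * N"
        using s r d d1 N(1) M(1) \<eta>(1) less_imp_le[OF d2(2)[of r]]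
        by (intro mult_right_mono mult_mono M) auto
      also have "\<dots> = \<eta> / 2 * norm w" using M(1) N(1) by simp
      finally have "\<bar>b (S r h - h) (S (r - s) w)\<bar> \<le> \<eta> / 2 * norm w" .
      moreover have "\<bar>b h (S (r - s) w) - b h w\<bar> \<le> \<eta> / 2 * norm w" using s r d by (intro d4) auto
      moreover have "b (S r h) (S (r - s) w) - b h w =
          b (S r h - h) (S (r - s) w) + (b h (S (r - s) w) - b h w)" by (simp add: b.diff_left)
      ultimately show ?thesis by linarith
    qed
    define z where "z = y r - S r h"
    have "((\<lambda>s. S (r - s) (D (u s) - B (y s))) has_integral z) {0..r}"
      using tr r unfolding trajectory_def z_def by simp
    from has_integral_linear[OF this b.bounded_linear_right[of "S r h"]]
    have "((\<lambda>s. b (S r h) (S (r - s) (D (u s) - B (y s)))) has_integral b (S r h) z) {0..r}"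
      by (simp add: o_def)
    moreover have "((\<lambda>s. (norm (y s))\<^sup>2 + (norm (u s))\<^sup>2) has_integral running_cost y u r) {0..r}"
      unfolding running_cost_def by (intro integrable_integral running_cost_integrable[OF tr]) simp
    ultimately have upper: "((\<lambda>s. ((norm (y s))\<^sup>2 + (norm (u s))\<^sup>2) +
        2 * b (S r h) (S (r - s) (D (u s) - B (y s)))) has_integral
        (running_cost y u r + 2 * b (S r h) z)) {0..r}"
      by (intro has_integral_add has_integral_mult_right)
    define L where "L = (norm h)\<^sup>2 - 2 * b h (B h) - (norm g)\<^sup>2 - e / 2"
    have lower: "((\<lambda>s. L) has_integral r * L) {0..r}"
      using has_integral_const_real[of L 0 r] r by simp
    have "r * L \<le> running_cost y u r + 2 * b (S r h) z"
    proof (rule has_integral_le[OF lower upper])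
      fix s assume s: "s \<in> {0..r}"
      have "g \<bullet> u s - \<eta> * (norm D * norm (u s)) \<le> b (S r h) (S (r - s) (D (u s)))"
      proof -
        have "\<eta> * norm (D (u s)) \<le> \<eta> * (norm D * norm (u s))"
          using \<eta>(1) by (intro mult_left_mono norm_blinfun) auto
        then show ?thesis using dual[OF s, of "D (u s)"] g[of "u s"] by linarith
      qed
      moreover have "b (S r h) (S (r - s) (B (y s))) \<le>
          b h (B h) + (norm h * N) * (norm B * norm (y s - h)) + \<eta> * (norm B * norm (y s))"
      proof -
        have "\<eta> * norm (B (y s)) \<le> \<eta> * (norm B * norm (y s))"
          using \<eta>(1) by (intro mult_left_mono norm_blinfun) auto
        moreover have "b h (B (y s)) = b h (B h) + b h (B (y s - h))"
          by (simp add: blinfun.bilinear_simps b.diff_right)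
        moreover have "b h (B (y s - h)) \<le> (norm h * N) * (norm B * norm (y s - h))"
        proof -
          have "b h (B (y s - h)) \<le> norm h * norm (B (y s - h)) * N"
            using N(2)[of h "B (y s - h)"] by simp
          also have "\<dots> \<le> norm h * (norm B * norm (y s - h)) * N"
            using N(1) by (intro mult_right_mono mult_left_mono norm_blinfun) auto
          finally show ?thesis by (simp add: mult_ac)
        qed
        ultimately show ?thesis using dual[OF s, of "B (y s)"] by linarith
      qed
      ultimately have "(norm h)\<^sup>2 - 2 * b h (B h) - (norm g)\<^sup>2 - \<eta> * k \<le>
          (norm (y s))\<^sup>2 + (norm (u s))\<^sup>2 +
          2 * (b (S r h) (S (r - s) (D (u s))) - b (S r h) (S (r - s) (B (y s))))"
        unfolding k_def using \<eta> N(1)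
        by (intro running_cost_pointwise_bound ys[OF s]) auto
      then show "L \<le> ((norm (y s))\<^sup>2 + (norm (u s))\<^sup>2) + 2 * b (S r h) (S (r - s) (D (u s) - B (y s)))"
        unfolding L_def using \<eta>k by (simp add: blinfun.bilinear_simps b.diff_right)
    qed
    moreover have "optimal_cost (y r) = optimal_cost (S r h) + 2 * b (S r h) z + optimal_cost z"
    proof -
      have "y r = S r h + z" unfolding z_def by simp
      then show ?thesis
        unfolding diag[symmetric] by (simp add: b.add_left b.add_right sym[of z "S r h"])
    qed
    moreover have "0 \<le> optimal_cost z" by (rule optimal_cost_nonneg)
    ultimately have "optimal_cost (S r h) + r * L \<le> optimal_cost h + e / 2 * r"
      using dp e'(3) by linarith
    then show ?thesis unfolding L_def by (simp add: algebra_simps)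
  qed
  then show ?thesis unfolding eventually_at_right_field using d(1) by (intro exI[of _ d]) auto
qed

section \<open>The optimal feedback\<close>

text \<open>Along the closed loop the expansion at \<open>S r h\<close> is exact to first order. Its terms involving \<open>B\<close> cancel
  those of the Riccati inequality, and the feedback \<open>K\<close> contributes \<open>- 2 * (norm (K h))\<^sup>2\<close> against
  \<open>(norm (K h))\<^sup>2\<close> there.\<close>

lemma optimal_feedback_dissipation:
  fixes K :: "'h \<Rightarrow>\<^sub>L 'u" and F :: "'h \<Rightarrow>\<^sub>L 'h"
  assumes bil: "bounded_bilinear b" and sym: "\<And>x y. b x y = b y x"
    and diag: "\<And>x. b x x = optimal_cost x"
    and K: "\<And>x v. b x (D v) = - (K x \<bullet> v)"
    and F: "\<And>x. F x = D (K x) - B x"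
    and y: "perturbed_orbit F h y" and e: "0 < e"
  shows "\<forall>\<^sub>F r in at_right 0. optimal_cost (y r) \<le> optimal_cost h - r * (norm h)\<^sup>2 + e * r"
proof -
  interpret b: bounded_bilinear b by (rule bil)
  define z where "z r = y r - S r h" for r
  have zr: "((\<lambda>r. z r /\<^sub>R r) \<longlongrightarrow> F h) (at_right 0)"
    unfolding z_def by (rule perturbed_orbit_derivative[OF y])
  have "((\<lambda>r. r *\<^sub>R (z r /\<^sub>R r)) \<longlongrightarrow> 0 *\<^sub>R F h) (at_right 0)"
    by (intro tendsto_scaleR tendsto_ident_at zr)
  moreover have "\<forall>\<^sub>F r in at_right 0. r *\<^sub>R (z r /\<^sub>R r) = z r"
    by (auto simp: eventually_at_right_field intro!: exI[of _ 1])
  ultimately have z0: "(z \<longlongrightarrow> 0) (at_right 0)"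
    using Lim_transform_eventually by fastforce
  have "((\<lambda>r. 2 * b (S r h) (z r /\<^sub>R r) + b (z r) (z r /\<^sub>R r)) \<longlongrightarrow>
      2 * b h (F h) + b 0 (F h)) (at_right 0)"
    by (intro tendsto_intros b.tendsto S_right_continuous zr z0)
  moreover have "2 * b h (F h) + b 0 (F h) < 2 * b h (F h) + e / 2" using e by (simp add: b.zero_left)
  ultimately have "\<forall>\<^sub>F r in at_right 0. 2 * b (S r h) (z r /\<^sub>R r) + b (z r) (z r /\<^sub>R r) < 2 * b h (F h) + e / 2"
    by (rule order_tendstoD(2))
  moreover have "\<forall>\<^sub>F r in at_right 0. optimal_cost (S r h) +
      r * ((norm h)\<^sup>2 - 2 * b h (B h) - (norm (- K h))\<^sup>2 - e / 2) \<le> optimal_cost h"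
    using e by (intro optimal_cost_lower_expansion bil sym diag) (auto simp: K)
  moreover have "\<forall>\<^sub>F r in at_right (0 :: real). 0 < r" by (rule eventually_at_right_less)
  ultimately show ?thesis
  proof eventually_elim
    case (elim r)
    have "optimal_cost (y r) = optimal_cost (S r h) + 2 * b (S r h) (z r) + b (z r) (z r)"
    proof -
      have "y r = S r h + z r" unfolding z_def by simp
      then show ?thesis
        unfolding diag[symmetric] by (simp add: b.add_left b.add_right sym[of "z r" "S r h"])
    qed
    moreover have "2 * b (S r h) (z r) + b (z r) (z r) \<le> r * (2 * b h (F h) + e / 2)"
    proof -
      have "2 * b (S r h) (z r) + b (z r) (z r) =
          r * (2 * b (S r h) (z r /\<^sub>R r) + b (z r) (z r /\<^sub>R r))"
        using elim(3) by (simp add: b.scaleR_right field_simps)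
      also have "\<dots> \<le> r * (2 * b h (F h) + e / 2)" using elim by (intro mult_left_mono) auto
      finally show ?thesis .
    qed
    moreover have "b h (F h) = - (norm (K h))\<^sup>2 - b h (B h)"
      by (simp add: F b.diff_right K power2_norm_eq_inner)
    moreover have "0 \<le> r * (norm (K h))\<^sup>2" using elim by simp
    ultimately show ?case using elim(2) by (simp add: algebra_simps)
  qed
qed

text \<open>The optimal cost is a Lyapunov function of the closed loop: by the dissipation inequality it pays for
  the integral of \<open>(norm (y s))\<^sup>2\<close>.\<close>

lemma optimal_feedback_square_integrable:
  fixes K :: "'h \<Rightarrow>\<^sub>L 'u" and F :: "'h \<Rightarrow>\<^sub>L 'h"
  assumes bil: "bounded_bilinear b" and sym: "\<And>x y. b x y = b y x"
    and diag: "\<And>x. b x x = optimal_cost x"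
    and K: "\<And>x v. b x (D v) = - (K x \<bullet> v)"
    and F: "\<And>x. F x = D (K x) - B x"
    and y: "perturbed_orbit F h y" and T: "0 \<le> T"
  shows "integral {0..T} (\<lambda>s. (norm (y s))\<^sup>2) \<le> C * (norm h)\<^sup>2"
proof -
  interpret b: bounded_bilinear b by (rule bil)
  have cont: "continuous_on {0..} y" using y unfolding perturbed_orbit_def by blast
  have nc: "continuous_on {a..c} (\<lambda>s. (norm (y s))\<^sup>2)" if "0 \<le> a" for a c
    using that by (intro continuous_intros continuous_on_subset[OF cont]) auto
  have ni: "(\<lambda>s. (norm (y s))\<^sup>2) integrable_on {a..c}" if "0 \<le> a" for a c
    by (intro integrable_continuous_interval nc that)
  define \<phi> where "\<phi> t = optimal_cost (y t) + integral {0..t} (\<lambda>s. (norm (y s))\<^sup>2)" for t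
  have "\<phi> T \<le> \<phi> 0"
  proof (rule nonincreasing_if_right_derivative_nonpos[OF _ _ T])
    have "continuous_on {0..T} (\<lambda>t. b (y t) (y t))"
      by (intro b.continuous_on continuous_on_subset[OF cont]) auto
    then show "continuous_on {0..T} \<phi>"
      unfolding \<phi>_def diag[symmetric]
      by (intro continuous_on_add indefinite_integral_continuous_1 ni) simp_all
  next
    fix t e :: real assume t: "0 \<le> t" and e: "0 < e"
    then have e2: "0 < e / 2" by simp
    have "\<forall>\<^sub>F r in at_right 0. optimal_cost (y (t + r)) \<le> optimal_cost (y t) - r * (norm (y t))\<^sup>2 + e / 2 * r"
      by (rule optimal_feedback_dissipation[OF bil sym diag K F perturbed_orbit_restart[OF y t] e2])
    then obtain d1 where d1: "0 < d1" "\<And>r. 0 < r \<Longrightarrow> r < d1 \<Longrightarrow>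
        optimal_cost (y (t + r)) \<le> optimal_cost (y t) - r * (norm (y t))\<^sup>2 + e / 2 * r"
      unfolding eventually_at_right_field by auto
    have "continuous_on {0..} (\<lambda>s. (norm (y s))\<^sup>2)" by (intro continuous_intros cont)
    then obtain d2 where d2: "0 < d2" "\<And>s. 0 \<le> s \<Longrightarrow> dist s t < d2 \<Longrightarrow>
        dist ((norm (y s))\<^sup>2) ((norm (y t))\<^sup>2) < e / 2"
      unfolding continuous_on_iff using t e2 by (metis atLeast_iff)
    have "\<phi> (t + r) \<le> \<phi> t + e * r" if r: "r \<in> {0<..<min d1 d2}" for r
    proof -
      have "integral {t..t + r} (\<lambda>s. (norm (y s))\<^sup>2) \<le> integral {t..t + r} (\<lambda>s. (norm (y t))\<^sup>2 + e / 2)"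
      proof (rule integral_le)
        fix s assume "s \<in> {t..t + r}"
        then have "0 \<le> s" "dist s t < d2" using t r by (auto simp: dist_real_def)
        then show "(norm (y s))\<^sup>2 \<le> (norm (y t))\<^sup>2 + e / 2"
          using d2(2)[of s] unfolding dist_real_def by linarith
      qed (use t in \<open>auto intro!: ni\<close>)
      also have "\<dots> = r * ((norm (y t))\<^sup>2 + e / 2)" using r by simp
      finally have "integral {t..t + r} (\<lambda>s. (norm (y s))\<^sup>2) \<le> r * ((norm (y t))\<^sup>2 + e / 2)" .
      moreover have "integral {0..t + r} (\<lambda>s. (norm (y s))\<^sup>2) =
          integral {0..t} (\<lambda>s. (norm (y s))\<^sup>2) + integral {t..t + r} (\<lambda>s. (norm (y s))\<^sup>2)"
        using t r by (intro Henstock_Kurzweil_Integration.integral_combine[symmetric] ni) auto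
      ultimately show ?thesis unfolding \<phi>_def using d1(2)[of r] r by (simp add: algebra_simps)
    qed
    then show "\<exists>d>0. \<forall>r\<in>{0<..<d}. \<phi> (t + r) \<le> \<phi> t + e * r"
      using d1(1) d2(1) by (intro exI[of _ "min d1 d2"]) auto
  qed
  moreover have "\<phi> 0 \<le> C * (norm h)\<^sup>2"
    unfolding \<phi>_def using optimal_cost_le[OF finite_cost] perturbed_orbit_start[OF y] by simp
  moreover have "0 \<le> optimal_cost (y T)" by (rule optimal_cost_nonneg)
  ultimately show ?thesis unfolding \<phi>_def by linarith
qed

text \<open>The feedback is \<open>- D* P\<close>, where \<open>P\<close> is the operator of the quadratic form \<open>optimal_cost\<close>.\<close>

theorem exponentially_stabilizing_feedback: "\<exists>K. exponentially_stable S B D (\<lambda>t. K)"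
proof -
  obtain b where bil: "bounded_bilinear b" and sym: "\<And>x y. b x y = b y x"
    and diag: "\<And>x. b x x = optimal_cost x"
    using optimal_cost_quadratic by blast
  interpret b: bounded_bilinear b by (rule bil)
  obtain N where N: "0 < N" "\<And>x y. norm (b x y) \<le> norm x * norm y * N" using b.pos_bounded by blast
  have "\<exists>k. \<forall>v. - b x (D v) = k \<bullet> v" for x
  proof -
    have "bounded_linear (\<lambda>v. - b x (D v))"
      by (intro bounded_linear_minus bounded_linear_compose[OF b.bounded_linear_right]
          blinfun.bounded_linear_right)
    from Riesz_on_closed_subspace[OF this subspace_UNIV closed_UNIV] show ?thesis by auto
  qed
  then obtain k where k: "\<And>x v. k x \<bullet> v = - b x (D v)" by metis
  have "bounded_linear k"
  proof (rule bounded_linear_intro)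
    show "k (x + y) = k x + k y" for x y
      by (rule vector_eq_rdot[THEN iffD1]) (simp add: k inner_add_left b.add_left)
    show "k (r *\<^sub>R x) = r *\<^sub>R k x" for r x
      by (rule vector_eq_rdot[THEN iffD1]) (simp add: k b.scaleR_left)
    show "norm (k x) \<le> norm x * (norm D * N)" for x
    proof (cases "k x = 0")
      case False
      have "norm (k x) * norm (k x) = - b x (D (k x))" using k[of x "k x"] by (simp add: dot_square_norm power2_eq_square)
      also have "\<dots> \<le> norm x * norm (D (k x)) * N" using N(2)[of x "D (k x)"] by simp
      also have "\<dots> \<le> norm x * (norm D * norm (k x)) * N"
        using N(1) by (intro mult_right_mono mult_left_mono norm_blinfun) auto
      finally have "norm (k x) * norm (k x) \<le> (norm x * (norm D * N)) * norm (k x)" by (simp add: mult_ac)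
      then show ?thesis using False by simp
    qed (use N(1) in simp)
  qed
  then have kK: "Blinfun k x = k x" for x by (simp add: bounded_linear_Blinfun_apply)
  define K where "K = Blinfun k"
  define F where "F = (D o\<^sub>L K) - B"
  have F: "F x = D (K x) - B x" for x unfolding F_def by (simp add: blinfun.diff_left)
  have K: "b x (D v) = - (K x \<bullet> v)" for x v unfolding K_def kK k by simp
  have mild: "mild_solution S B D (\<lambda>t. K) h y \<longleftrightarrow> perturbed_orbit F h y" for h y
    unfolding mild_solution_def perturbed_orbit_def F ..
  define \<Phi> where "\<Phi> t h = (SOME y. perturbed_orbit F h y) t" for t h
  have \<Phi>: "perturbed_orbit F h (\<lambda>t. \<Phi> t h)" for h
    unfolding \<Phi>_def using someI_ex[OF perturbed_orbit_exists] .
  obtain M where M: "\<And>h y t. perturbed_orbit F h y \<Longrightarrow> t \<in> {0..1} \<Longrightarrow> norm (y t) \<le> M * norm h"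
    using perturbed_orbit_bound[of F 1] by blast
  have "\<exists>L>0. \<exists>d>0. \<forall>t\<ge>0. \<forall>x. norm (\<Phi> t x) \<le> L * exp (- d * t) * norm x"
  proof (rule exponential_decay_if_square_integrable[of \<Phi> M C])
    show "\<Phi> (s + t) x = \<Phi> s (\<Phi> t x)" if "0 \<le> s" "0 \<le> t" for s t x
      using perturbed_orbit_unique[OF perturbed_orbit_restart[OF \<Phi> that(2)] \<Phi> that(1)]
      by (simp add: add.commute)
    show "continuous_on {0..} (\<lambda>t. \<Phi> t x)" for x using \<Phi> unfolding perturbed_orbit_def by blast
    show "norm (\<Phi> t x) \<le> M * norm x" if "t \<in> {0..1}" for t x by (rule M[OF \<Phi> that])
    show "integral {0..t} (\<lambda>s. (norm (\<Phi> s x))\<^sup>2) \<le> C * (norm x)\<^sup>2" if "0 \<le> t" for t x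
      by (rule optimal_feedback_square_integrable[OF bil sym diag K F \<Phi> that])
  qed
  then obtain L d where L: "0 < L" "0 < d" "\<And>t x. 0 \<le> t \<Longrightarrow> norm (\<Phi> t x) \<le> L * exp (- d * t) * norm x"
    by blast
  have "exponentially_stable S B D (\<lambda>t. K)"
    unfolding exponentially_stable_def mild
  proof (rule exI[of _ L], rule conjI[OF L(1)], rule exI[of _ d], rule conjI[OF L(2)],
      intro allI conjI impI)
    fix h
    show "\<exists>y. perturbed_orbit F h y" by (rule perturbed_orbit_exists)
    fix y and t :: real
    assume y: "perturbed_orbit F h y" and t: "0 \<le> t"
    show "norm (y t) \<le> L * exp (- d * t) * norm h"
      unfolding perturbed_orbit_unique[OF y \<Phi> t] by (rule L(3)[OF t])
  qed
  then show ?thesis by blast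
qed

end

section \<open>Stabilization by periodic and by constant feedback\<close>

text \<open>The control that a stable feedback loop produces is an open-loop control whose cost is bounded by the
  integral of a decaying exponential.\<close>

lemma (in control_system) admissible_cost_of_stable_feedback:
  assumes K: "L_infinity K" and stable: "exponentially_stable S B D K"
  shows "\<exists>C. \<forall>h. admissible_cost h (C * (norm h)\<^sup>2)"
proof -
  obtain M \<delta> where M: "0 < M" "0 < \<delta>" and ex: "\<And>h. \<exists>y. mild_solution S B D K h y"
    and decay: "\<And>h y t. mild_solution S B D K h y \<Longrightarrow> 0 \<le> t \<Longrightarrow> norm (y t) \<le> M * exp (- \<delta> * t) * norm h"
    using stable unfolding exponentially_stable_def by blast
  obtain s c where s: "\<And>n :: nat. simple_function lebesgue (s n)"
    "AE t in lebesgue. 0 \<le> t \<longrightarrow> (\<lambda>n. s n t) \<longlonglongrightarrow> K t"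
    and c: "AE t in lebesgue. 0 \<le> t \<longrightarrow> norm (K t) \<le> c"
    using K unfolding L_infinity_def by auto
  obtain Z where Z: "{t. \<not> (0 \<le> t \<longrightarrow> norm (K t) \<le> c)} \<subseteq> Z" "Z \<in> null_sets lebesgue"
    using c unfolding eventually_ae_filter by auto
  \<comment> \<open>make the bound on \<open>K\<close> hold everywhere\<close>
  define K' where "K' t = (if t \<in> Z then 0 else K t)" for t
  have "AE t in lebesgue. t \<notin> Z" using Z(2) by (rule AE_not_in)
  then have "AE t in lebesgue. 0 \<le> t \<longrightarrow> (\<lambda>n. s n t) \<longlonglongrightarrow> K' t"
    using s(2) by eventually_elim (auto simp: K'_def)
  then have K'm: "strongly_measurable K'" unfolding strongly_measurable_def using s(1) by (intro exI[of _ s]) auto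
  have K'b: "norm (K' t) \<le> \<bar>c\<bar>" if "0 \<le> t" for t using Z(1) that unfolding K'_def by force
  define C where "C = (1 + c\<^sup>2) * M\<^sup>2 / (2 * \<delta>)"
  have "admissible_cost h (C * (norm h)\<^sup>2)" for h
  proof -
    obtain y where y: "mild_solution S B D K h y" using ex by blast
    define u where "u t = K' t (y t)" for t
    have cont: "continuous_on {0..} y" using y unfolding mild_solution_def by blast
    have um: "strongly_measurable u"
      unfolding u_def by (intro strongly_measurable_apply K'm strongly_measurable_continuous cont)
    have ub: "(norm (u t))\<^sup>2 \<le> c\<^sup>2 * (norm (y t))\<^sup>2" if "0 \<le> t" for t
    proof -
      have "norm (u t) \<le> norm (K' t) * norm (y t)" unfolding u_def by (rule norm_blinfun)
      also have "\<dots> \<le> \<bar>c\<bar> * norm (y t)" using K'b[OF that] by (intro mult_right_mono) auto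
      finally have "(norm (u t))\<^sup>2 \<le> (\<bar>c\<bar> * norm (y t))\<^sup>2" by (intro power_mono) auto
      then show ?thesis by (simp add: power_mult_distrib)
    qed
    have tr: "trajectory h y u"
      unfolding trajectory_def
    proof (intro conjI allI impI cont um)
      fix t :: real assume t: "0 \<le> t"
      have "((\<lambda>s. S (t - s) (D (K s (y s)) - B (y s))) has_integral (y t - S t h)) {0..t}"
        using y t unfolding mild_solution_def by blast
      then show "((\<lambda>s. S (t - s) (D (u s) - B (y s))) has_integral (y t - S t h)) {0..t}"
        by (rule has_integral_spike[rotated 2])
          (use Z(2) in \<open>auto simp: negligible_iff_null_sets u_def K'_def\<close>)
      have "(\<lambda>s. c\<^sup>2 * (norm (y s))\<^sup>2) integrable_on {0..t}"
        by (intro integrable_continuous_interval continuous_intros continuous_on_subset[OF cont]) auto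
      then show "(\<lambda>s. (norm (u s))\<^sup>2) integrable_on {0..t}"
        by (rule strongly_measurable_square_integrable[OF um]) (auto simp: ub)
    qed
    have "running_cost y u t \<le> C * (norm h)\<^sup>2" if t: "0 \<le> t" for t
    proof -
      define A where "A = (1 + c\<^sup>2) * (M * norm h)\<^sup>2"
      have A: "0 \<le> A" unfolding A_def by simp
      have hi: "((\<lambda>s. A * exp (- (2 * \<delta>) * s)) has_integral
          (- (A * exp (- (2 * \<delta>) * t) / (2 * \<delta>)) - - (A * exp (- (2 * \<delta>) * 0) / (2 * \<delta>)))) {0..t}"
        using t M by (intro fundamental_theorem_of_calculus)
          (auto intro!: derivative_eq_intros simp flip: has_real_derivative_iff_has_vector_derivative)
      have "running_cost y u t \<le> integral {0..t} (\<lambda>s. A * exp (- (2 * \<delta>) * s))"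
        unfolding running_cost_def
      proof (rule integral_le)
        show "(\<lambda>s. (norm (y s))\<^sup>2 + (norm (u s))\<^sup>2) integrable_on {0..t}"
          by (rule running_cost_integrable[OF tr]) simp
        show "(\<lambda>s. A * exp (- (2 * \<delta>) * s)) integrable_on {0..t}" using hi by blast
        fix s assume s: "s \<in> {0..t}"
        have "norm (y s) \<le> M * exp (- \<delta> * s) * norm h" using decay[OF y] s by simp
        then have "(norm (y s))\<^sup>2 \<le> (M * exp (- \<delta> * s) * norm h)\<^sup>2" by (intro power_mono) auto
        also have "\<dots> = (M * norm h)\<^sup>2 * exp (- (2 * \<delta>) * s)"
          by (simp add: power_mult_distrib exp_double[symmetric] mult_ac)
        finally have ys: "(norm (y s))\<^sup>2 \<le> (M * norm h)\<^sup>2 * exp (- (2 * \<delta>) * s)" .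
        have "(norm (y s))\<^sup>2 + (norm (u s))\<^sup>2 \<le> (1 + c\<^sup>2) * (norm (y s))\<^sup>2"
          using ub[of s] s by (simp add: algebra_simps)
        also have "\<dots> \<le> (1 + c\<^sup>2) * ((M * norm h)\<^sup>2 * exp (- (2 * \<delta>) * s))"
          by (intro mult_left_mono ys) auto
        finally show "(norm (y s))\<^sup>2 + (norm (u s))\<^sup>2 \<le> A * exp (- (2 * \<delta>) * s)"
          unfolding A_def by (simp add: mult.assoc)
      qed
      also have "\<dots> = A / (2 * \<delta>) - A * exp (- (2 * \<delta>) * t) / (2 * \<delta>)"
        using integral_unique[OF hi] by simp
      also have "\<dots> \<le> A / (2 * \<delta>)" using A M by simp
      also have "\<dots> = C * (norm h)\<^sup>2" unfolding A_def C_def by (simp add: power_mult_distrib)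
      finally show ?thesis .
    qed
    then show ?thesis using tr unfolding admissible_cost_def by blast
  qed
  then show ?thesis by blast
qed

lemma time_invariant_if_periodic_stabilizable:
  fixes S :: "real \<Rightarrow> 'h::{real_inner, banach} \<Rightarrow>\<^sub>L 'h"
    and D :: "'u::{real_inner, banach} \<Rightarrow>\<^sub>L 'h"
  assumes "C0_semigroup S" "periodic_feedback_stabilizable S B D T"
  shows "time_invariant_feedback_stabilizable S B D"
proof -
  interpret control_system S B D by standard (rule assms(1))
  obtain C where "\<And>h. admissible_cost h (C * (norm h)\<^sup>2)"
    using admissible_cost_of_stable_feedback assms(2)
    unfolding periodic_feedback_stabilizable_def by blast
  then interpret finite_cost_system S B D C by unfold_locales
  show ?thesis
    unfolding time_invariant_feedback_stabilizable_def by (rule exponentially_stabilizing_feedback)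
qed

lemma periodic_if_time_invariant_stabilizable:
  assumes "time_invariant_feedback_stabilizable S B D"
  shows "periodic_feedback_stabilizable S B D T"
proof -
  obtain K where "exponentially_stable S B D (\<lambda>t. K)"
    using assms unfolding time_invariant_feedback_stabilizable_def by blast
  moreover have "L_infinity (\<lambda>t. K)"
    unfolding L_infinity_def by (auto intro!: exI[of _ "\<lambda>n t. K"] exI[of _ "norm K"])
  ultimately show ?thesis unfolding periodic_feedback_stabilizable_def by (intro exI[of _ "\<lambda>t. K"]) auto
qed

theorem proposition3p3:
  fixes A :: "'h::{real_inner, banach} \<Rightarrow> 'h"
    and domA :: "'h set"
    and S :: "real \<Rightarrow> 'h \<Rightarrow>\<^sub>L 'h"
    and B :: "'h \<Rightarrow>\<^sub>L 'h"
    and D :: "'u::{real_inner, banach} \<Rightarrow>\<^sub>L 'h"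
  assumes "compact_C0_semigroup S"
    and "generates domA (\<lambda>x. - A x) S"
  shows "((\<exists>T>0. periodic_feedback_stabilizable S B D T) \<longleftrightarrow>
          (\<forall>T>0. periodic_feedback_stabilizable S B D T)) \<and>
         ((\<forall>T>0. periodic_feedback_stabilizable S B D T) \<longleftrightarrow>
          time_invariant_feedback_stabilizable S B D)"
proof -
  have S: "C0_semigroup S" using assms(1) unfolding compact_C0_semigroup_def by blast
  have "time_invariant_feedback_stabilizable S B D" if "\<exists>T>0. periodic_feedback_stabilizable S B D T"
    using that time_invariant_if_periodic_stabilizable[OF S] by blast
  moreover have "\<forall>T>0. periodic_feedback_stabilizable S B D T" if "time_invariant_feedback_stabilizable S B D"
    using that periodic_if_time_invariant_stabilizable by blast
  moreover have "\<exists>T>0. periodic_feedback_stabilizable S B D T" if "\<forall>T>0. periodic_feedback_stabilizable S B D T"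
    using that zero_less_one by blast
  ultimately show ?thesis by blast
qed

end
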